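(* There exists a constant $0<\alpha_0\le1/20$ such that if $d\le\alpha_0\frac{N}{\log N}$ then, for every $d$-partition $\Lambda$ of $\{1,\dots,N\}$ and every $x\in\mathcal S_d=\{-1,1\}^d$, the associated lumped chain satisfies $$0\le\Bigl(1-\frac1N\Bigr)-\mathbb P^\circ(\tau^x_0<\tau^x_x)\le\frac{3}{N^2}\bigl(1+O(1/\sqrt N)\bigr).$$
   Context: Let $(\sigma_N(t))_{t\in\mathbb N}$ be the discrete-time simple random walk on $\{-1,1\}^N$ (jump to each Hamming neighbour with probability $1/N$). A $d$-partition $\Lambda$ is a partition of $\{1,\dots,N\}$ into nonempty classes $\Lambda_1,\dots,\Lambda_d$. Let $\gamma(\sigma)=(\gamma_1(\sigma),\dots,\gamma_d(\sigma))$ with $\gamma_k(\sigma)=|\Lambda_k|^{-1}\sum_{i\in\Lambda_k}\sigma_i$, $\Gamma_{N,d}=\gamma(\{-1,1\}^N)\supset\{-1,1\}^d$. The lumped chain $X_N(t)=\gamma(\sigma_N(t))$ is a Markov chain on $\Gamma_{N,d}$ with transition probabilities $r_N(x,x+s\frac{2}{|\Lambda_k|}u_k)=\frac{|\Lambda_k|}{N}\frac{1-sx_k}{2}$ ($s\in\{\pm1\}$, $u_k$ canonical basis vectors) and reversible invariant measure $\mathbb Q_N(x)=2^{-N}\prod_k\binom{|\Lambda_k|}{|\Lambda_k|(1+x_k)/2}$. $\mathbb P^\circ$ is its law; $\tau^x_J=\inf\{t>0:X_N(t)\in J\}$ for the chain started at $x$ (and $\tau^x_y=\tau^x_{\{y\}}$).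 The symbol $0$ denotes a fixed point of $\Gamma_{N,d}$ at which $\mathbb Q_N$ attains its maximum (the origin when all $|\Lambda_k|$ are even). *)

theory Defs
  imports Complex_Main
begin

text \<open>A d-partition of {0..<N} (0-based indices) is encoded by a labelling
  lab :: nat => nat; class k (k < d) is {i. i < N \<and> lab i = k}, every class nonempty.\<close>
definition is_partition :: "nat \<Rightarrow> nat \<Rightarrow> (nat \<Rightarrow> nat) \<Rightarrow> bool" where
  "is_partition N d lab \<longleftrightarrow> (\<forall>i<N. lab i < d) \<and> (\<forall>k<d. \<exists>i<N. lab i = k)"

definition cls_size :: "nat \<Rightarrow> (nat \<Rightarrow> nat) \<Rightarrow> nat \<Rightarrow> nat" where
  "cls_size N lab k = card {i. i < N \<and> lab i = k}"

text \<open>Points of R^d are functions nat => real vanishing at indices >= d.\<close>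
definition gamma :: "nat \<Rightarrow> nat \<Rightarrow> (nat \<Rightarrow> nat) \<Rightarrow> (nat \<Rightarrow> real) \<Rightarrow> (nat \<Rightarrow> real)" where
  "gamma N d lab \<sigma> = (\<lambda>k. if k < d then
      (\<Sum>i\<in>{i. i < N \<and> lab i = k}. \<sigma> i) / real (cls_size N lab k) else 0)"

definition Gamma :: "nat \<Rightarrow> nat \<Rightarrow> (nat \<Rightarrow> nat) \<Rightarrow> (nat \<Rightarrow> real) set" where
  "Gamma N d lab = gamma N d lab ` {\<sigma>. \<forall>i<N. \<sigma> i \<in> {-1, 1}}"

definition cube :: "nat \<Rightarrow> (nat \<Rightarrow> real) set" where
  "cube d = {x. (\<forall>k<d. x k \<in> {-1, 1}) \<and> (\<forall>k\<ge>d. x k = 0)}"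

definition unit_vec :: "nat \<Rightarrow> nat \<Rightarrow> real" where
  "unit_vec k = (\<lambda>j. if j = k then 1 else 0)"

definition trans_prob :: "nat \<Rightarrow> nat \<Rightarrow> (nat \<Rightarrow> nat) \<Rightarrow> (nat \<Rightarrow> real) \<Rightarrow> (nat \<Rightarrow> real) \<Rightarrow> real" where
  "trans_prob N d lab x y =
     (\<Sum>k<d. \<Sum>s\<in>{-1::real, 1}.
        if y = (\<lambda>j. x j + s * (2 / real (cls_size N lab k)) * unit_vec k j)
        then real (cls_size N lab k) / real N * (1 - s * x k) / 2 else 0)"

text \<open>Invariant measure Q_N(x) = 2^{-N} prod_k binom(|\<Lambda>_k|, |\<Lambda>_k|(1+x_k)/2).\<close>
definition QN :: "nat \<Rightarrow> nat \<Rightarrow> (nat \<Rightarrow> nat) \<Rightarrow> (nat \<Rightarrow> real) \<Rightarrow> real" where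
  "QN N d lab x = (1 / 2 ^ N) * (\<Prod>k<d.
      real (cls_size N lab k choose nat (round (real (cls_size N lab k) * (1 + x k) / 2))))"

definition path_prob :: "('a \<Rightarrow> 'a \<Rightarrow> real) \<Rightarrow> 'a list \<Rightarrow> real" where
  "path_prob r xs = (\<Prod>i < length xs - 1. r (xs ! i) (xs ! Suc i))"

text \<open>P(tau^x_a < tau^x_b) for the chain with kernel r on state space S started at x,
  where tau^x_J = inf {t > 0. X(t) \<in> J}: sum over n of the probabilities of all paths
  x, y_1, ..., y_n, a whose intermediate states avoid {a, b}.\<close>
definition hit_before :: "'a set \<Rightarrow> ('a \<Rightarrow> 'a \<Rightarrow> real) \<Rightarrow> 'a \<Rightarrow> 'a \<Rightarrow> 'a \<Rightarrow> real" where
  "hit_before S r x a b = (if a = b then 0 else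
     (\<Sum>n. \<Sum>ys\<in>{ys. set ys \<subseteq> S - {a, b} \<and> length ys = n}. path_prob r (x # ys @ [a])))"

end

theory Submission
  imports Defs
begin

text \<open>Let \<open>h\<close> be the probability of hitting the maximum \<open>z\<close> before the corner \<open>x\<close>, so that
  \<open>P = (\<Sum>w. r x w * h w)\<close> is the escape probability, and let \<open>H\<^sub>j\<close> be the mean of \<open>h\<close> under the
  invariant measure conditioned on Hamming distance \<open>j\<close> from \<open>x\<close>. By reversibility the harmonicity
  of \<open>h\<close> passes to \<open>H\<close>, which is therefore harmonic for the Ehrenfest chain below the level of
  \<open>z\<close>; hence \<open>H\<^sub>m = P * (\<Sum>i<m. 1 / (N - 1 choose i))\<close>. Taking \<open>m = 2\<close> and \<open>H\<^sub>2 \<le> 1\<close> gives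
  \<open>P \<le> 1 - 1/N\<close>. For \<open>m = N div 4\<close> the sum is \<open>1 + 1/N + 3/N\<^sup>2 + O(N\<^sup>-\<^sup>3)\<close>, and it remains to see
  that \<open>1 - H\<^sub>m\<close> is exponentially small. Relative to the weight of \<open>x\<close>, the Dirichlet energy of
  \<open>h\<close> is \<open>P \<le> 1\<close>, so the increment of \<open>h\<close> over an edge at \<open>u\<close> is at most \<open>\<surd>(2N / W u)\<close>; from each
  state there is a path of length at most \<open>N\<close> to \<open>z\<close> along which \<open>W\<close> does not decrease. Summing over
  level \<open>m\<close>, whose total weight is \<open>N choose m\<close> and which has at most
  \<open>(N + 1) ^ d \<le> exp (2 * \<alpha>0 * N)\<close> states, gives the bound.\<close>

section \<open>Hitting potentials of finite chains\<close>

lemma path_prob_Cons_Cons: "path_prob r (u # w # ys) = r u w * path_prob r (w # ys)"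
  by (simp add: path_prob_def prod.lessThan_Suc_shift del: prod.lessThan_Suc)

locale finite_chain =
  fixes S :: "'a set" and r :: "'a \<Rightarrow> 'a \<Rightarrow> real"
  assumes finite_states: "finite S"
    and kernel_nonneg: "\<And>u w. u \<in> S \<Longrightarrow> w \<in> S \<Longrightarrow> 0 \<le> r u w"
    and kernel_row_sum: "\<And>u. u \<in> S \<Longrightarrow> (\<Sum>w\<in>S. r u w) = 1"
begin

text \<open>The n-th summand of \<open>hit_before\<close>: the probability that the chain from
  \<open>u\<close> enters \<open>{a, b}\<close> at time \<open>n + 1\<close> for the first time
  after the start, and does so at \<open>a\<close>.\<close>

definition passage :: "'a \<Rightarrow> 'a \<Rightarrow> nat \<Rightarrow> 'a \<Rightarrow> real" where
  "passage a b n u =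
     (\<Sum>ys\<in>{ys. set ys \<subseteq> S - {a, b} \<and> length ys = n}. path_prob r (u # ys @ [a]))"

lemma passage_0: "passage a b 0 u = r u a"
proof -
  have "{ys. set ys \<subseteq> S - {a, b} \<and> length ys = 0} = {[]}" by auto
  then show ?thesis by (simp add: passage_def path_prob_def)
qed

lemma passage_Suc: "passage a b (Suc n) u = (\<Sum>w\<in>S - {a, b}. r u w * passage a b n w)"
proof -
  let ?L = "{ys. set ys \<subseteq> S - {a, b} \<and> length ys = n}"
  have inj: "inj_on (\<lambda>(ys, w). w # ys) (?L \<times> (S - {a, b}))"
    by (auto simp: inj_on_def)
  have "passage a b (Suc n) u =
      (\<Sum>p\<in>?L \<times> (S - {a, b}). path_prob r (u # (case p of (ys, w) \<Rightarrow> w # ys) @ [a]))"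
    unfolding passage_def lists_length_Suc_eq by (subst sum.reindex[OF inj]) simp
  also have "\<dots> = (\<Sum>ys\<in>?L. \<Sum>w\<in>S - {a, b}. r u w * path_prob r (w # ys @ [a]))"
    by (simp add: sum.cartesian_product path_prob_Cons_Cons case_prod_unfold)
  also have "\<dots> = (\<Sum>w\<in>S - {a, b}. \<Sum>ys\<in>?L. r u w * path_prob r (w # ys @ [a]))"
    by (rule sum.swap)
  finally show ?thesis by (simp add: passage_def sum_distrib_left)
qed

lemma passage_nonneg: "a \<in> S \<Longrightarrow> u \<in> S \<Longrightarrow> 0 \<le> passage a b n u"
proof (induction n arbitrary: u)
  case 0
  then show ?case by (simp add: passage_0 kernel_nonneg)
next
  case (Suc n)
  then show ?case by (auto simp: passage_Suc intro!: sum_nonneg mult_nonneg_nonneg kernel_nonneg)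
qed

lemma sum_split_two:
  assumes "a \<in> S" "b \<in> S" "a \<noteq> b"
  shows "(\<Sum>w\<in>S. f w) = f a + f b + (\<Sum>w\<in>S - {a, b}. f w :: real)"
proof -
  have "(\<Sum>w\<in>S. f w) = (\<Sum>w\<in>S - {a, b}. f w) + (\<Sum>w\<in>{a, b}. f w)"
    using assms finite_states by (intro sum.subset_diff) auto
  then show ?thesis using assms by simp
qed

text \<open>Induction on the number of terms: the first step ends at \<open>a\<close>, is lost at
  \<open>b\<close>, or leads to an intermediate state, where the induction hypothesis bounds the
  rest by 1. Since passage probabilities are nonnegative, this gives summability.\<close>

lemma passage_partial_sum_le_1:
  assumes "a \<in> S" "b \<in> S" "a \<noteq> b" "u \<in> S"
  shows "(\<Sum>n<M. passage a b n u) \<le> 1"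
  using assms(4)
proof (induction M arbitrary: u)
  case 0
  then show ?case by simp
next
  case (Suc M)
  have "(\<Sum>n<Suc M. passage a b n u) = r u a + (\<Sum>n<M. \<Sum>w\<in>S - {a, b}. r u w * passage a b n w)"
    by (simp add: sum.lessThan_Suc_shift passage_0 passage_Suc del: sum.lessThan_Suc)
  also have "(\<Sum>n<M. \<Sum>w\<in>S - {a, b}. r u w * passage a b n w)
      = (\<Sum>w\<in>S - {a, b}. r u w * (\<Sum>n<M. passage a b n w))"
    by (subst sum.swap) (simp add: sum_distrib_left)
  also have "\<dots> \<le> (\<Sum>w\<in>S - {a, b}. r u w * 1)"
    using Suc by (intro sum_mono mult_left_mono kernel_nonneg) auto
  also have "r u a + (\<Sum>w\<in>S - {a, b}. r u w * 1) \<le> 1"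
    using sum_split_two[OF assms(1-3), of "r u"] kernel_row_sum[of u] kernel_nonneg[of u b] Suc.prems assms
    by simp
  finally show ?case by simp
qed

text \<open>The sum \<open>g\<close> of the passage probabilities satisfies the first-step equation
  at every state; resetting it to 1 at \<open>a\<close> and to 0 at \<open>b\<close> gives the
  potential. The unmodified value \<open>g b\<close> is the escape probability, whence the last
  equation.\<close>

lemma hitting_potential_exists:
  assumes "a \<in> S" "b \<in> S" "a \<noteq> b"
  obtains h where "\<And>u. u \<in> S \<Longrightarrow> 0 \<le> h u \<and> h u \<le> 1" "h a = 1" "h b = 0"
    "\<And>u. u \<in> S \<Longrightarrow> u \<noteq> a \<Longrightarrow> u \<noteq> b \<Longrightarrow> h u = (\<Sum>w\<in>S. r u w * h w)"
    "hit_before S r b a b = (\<Sum>w\<in>S. r b w * h w)"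
proof -
  define g where "g u = (\<Sum>n. passage a b n u)" for u
  define h where "h u = (if u = a then 1 else if u = b then 0 else g u)" for u
  have summ: "summable (\<lambda>n. passage a b n u)" if "u \<in> S" for u
    using that assms
    by (intro bounded_imp_summable[where B = 1])
       (auto simp: passage_nonneg lessThan_Suc_atMost[symmetric] simp del: sum.lessThan_Suc
             intro!: passage_partial_sum_le_1)
  have g_le: "g u \<le> 1" if "u \<in> S" for u
    unfolding g_def using that assms summ
    by (intro suminf_le_const passage_partial_sum_le_1) auto
  have g_ge: "0 \<le> g u" if "u \<in> S" for u
    unfolding g_def using that assms summ by (intro suminf_nonneg passage_nonneg) auto
  have g_eq: "g u = (\<Sum>w\<in>S. r u w * h w)" if u: "u \<in> S" for u
  proof -
    have "g u = passage a b 0 u + (\<Sum>n. passage a b (Suc n) u)"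
      unfolding g_def using suminf_split_head[OF summ[OF u]] by simp
    also have "(\<Sum>n. passage a b (Suc n) u) = (\<Sum>w\<in>S - {a, b}. \<Sum>n. r u w * passage a b n w)"
      unfolding passage_Suc using summ by (intro suminf_sum) auto
    also have "\<dots> = (\<Sum>w\<in>S - {a, b}. r u w * h w)"
      using summ by (intro sum.cong) (auto simp: suminf_mult h_def g_def)
    finally show ?thesis
      using sum_split_two[OF assms, of "\<lambda>w. r u w * h w"] assms by (simp add: passage_0 h_def)
  qed
  show ?thesis
  proof (rule that[of h])
    show "hit_before S r b a b = (\<Sum>w\<in>S. r b w * h w)"
      using g_eq[OF assms(2)] assms by (simp add: hit_before_def g_def passage_def)
  qed (use g_le g_ge g_eq assms in \<open>auto simp: h_def\<close>)
qed

end

section \<open>Reversibility and the Dirichlet energy of a potential\<close>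

locale reversible_chain = finite_chain +
  fixes W :: "'a \<Rightarrow> real"
  assumes weight_pos: "\<And>u. u \<in> S \<Longrightarrow> 0 < W u"
    and detailed_balance: "\<And>u w. u \<in> S \<Longrightarrow> w \<in> S \<Longrightarrow> W u * r u w = W w * r w u"
begin

text \<open>The kernel is self-adjoint with respect to \<open>W\<close>. For \<open>A = S\<close>
  this is stationarity; for a level set \<open>A\<close> it carries averages over one level to the
  neighbouring levels.\<close>

lemma sum_weight_kernel_swap:
  assumes "A \<subseteq> S"
  shows "(\<Sum>u\<in>A. W u * (\<Sum>w\<in>S. r u w * f w)) = (\<Sum>w\<in>S. W w * f w * (\<Sum>u\<in>A. r w u))"
proof -
  have "(\<Sum>u\<in>A. W u * (\<Sum>w\<in>S. r u w * f w)) = (\<Sum>u\<in>A. \<Sum>w\<in>S. W w * f w * r w u)"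
    unfolding sum_distrib_left
  proof (intro sum.cong refl)
    fix u w assume "u \<in> A" "w \<in> S"
    with assms detailed_balance[of u w] show "W u * (r u w * f w) = W w * f w * r w u"
      by (metis mult.assoc mult.commute subsetD)
  qed
  also have "\<dots> = (\<Sum>w\<in>S. \<Sum>u\<in>A. W w * f w * r w u)" by (rule sum.swap)
  finally show ?thesis by (simp add: sum_distrib_left)
qed

text \<open>Expanding the square and using stationarity, the energy is twice the
  \<open>W\<close>-inner product of \<open>h\<close> and \<open>h - Ph\<close>. Harmonicity and
  \<open>h b = 0\<close> leave only the term at \<open>a\<close>; it equals the flux at
  \<open>b\<close> because \<open>W * (h - Ph)\<close> sums to zero.\<close>

lemma dirichlet_energy_eq:
  assumes ab: "a \<in> S" "b \<in> S" "a \<noteq> b" and "h a = 1" "h b = 0"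
    and harm: "\<And>u. u \<in> S \<Longrightarrow> u \<noteq> a \<Longrightarrow> u \<noteq> b \<Longrightarrow> h u = (\<Sum>w\<in>S. r u w * h w)"
  shows "(\<Sum>u\<in>S. \<Sum>w\<in>S. W u * r u w * (h u - h w)\<^sup>2) = 2 * (W b * (\<Sum>w\<in>S. r b w * h w))"
proof -
  define Ph where "Ph u = (\<Sum>w\<in>S. r u w * h w)" for u
  have swap: "(\<Sum>u\<in>S. W u * (\<Sum>w\<in>S. r u w * f w)) = (\<Sum>u\<in>S. W u * f u)" for f
    using sum_weight_kernel_swap[of S f] kernel_row_sum by simp
  have row: "(\<Sum>w\<in>S. W u * r u w * (h u - h w)\<^sup>2)
      = W u * (h u)\<^sup>2 + W u * (\<Sum>w\<in>S. r u w * (h w)\<^sup>2) - 2 * (W u * h u * Ph u)" if "u \<in> S" for u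
  proof -
    have "(\<Sum>w\<in>S. W u * r u w * (h u - h w)\<^sup>2) =
      (\<Sum>w\<in>S. W u * (h u)\<^sup>2 * r u w + W u * (r u w * (h w)\<^sup>2) - 2 * (W u * h u * (r u w * h w)))"
      by (intro sum.cong) (auto simp: power2_eq_square algebra_simps)
    also have "\<dots> = W u * (h u)\<^sup>2 * (\<Sum>w\<in>S. r u w) + W u * (\<Sum>w\<in>S. r u w * (h w)\<^sup>2)
        - 2 * (W u * h u * Ph u)"
      by (simp add: sum.distrib sum_subtractf sum_distrib_left Ph_def)
    finally show ?thesis using kernel_row_sum[OF that] by simp
  qed
  have "(\<Sum>u\<in>S. \<Sum>w\<in>S. W u * r u w * (h u - h w)\<^sup>2)
      = (\<Sum>u\<in>S. W u * (h u)\<^sup>2) + (\<Sum>u\<in>S. W u * (\<Sum>w\<in>S. r u w * (h w)\<^sup>2))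
        - 2 * (\<Sum>u\<in>S. W u * h u * Ph u)"
    by (simp only: row sum.distrib sum_subtractf sum_distrib_left cong: sum.cong)
  also have "\<dots> = 2 * (\<Sum>u\<in>S. W u * h u * (h u - Ph u))"
    unfolding swap by (simp add: right_diff_distrib sum_subtractf power2_eq_square mult.assoc)
  also have "(\<Sum>u\<in>S. W u * h u * (h u - Ph u)) = W a * (1 - Ph a)"
    using assms by (subst sum_split_two[OF ab]) (auto simp: Ph_def)
  also have "W a * (1 - Ph a) = W b * Ph b"
  proof -
    have "0 = (\<Sum>u\<in>S. W u * (h u - Ph u))"
      using swap[of h] by (simp add: Ph_def algebra_simps sum_subtractf)
    also have "\<dots> = W a * (1 - Ph a) + W b * (0 - Ph b)"
      using assms by (subst sum_split_two[OF ab]) (auto simp: Ph_def)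
    finally show ?thesis by simp
  qed
  finally show ?thesis by (simp add: Ph_def)
qed

text \<open>All edge contributions are nonnegative, so each is at most the total energy.\<close>

lemma potential_edge_bound:
  assumes ab: "a \<in> S" "b \<in> S" "a \<noteq> b" and h: "h a = 1" "h b = 0"
    and harm: "\<And>u. u \<in> S \<Longrightarrow> u \<noteq> a \<Longrightarrow> u \<noteq> b \<Longrightarrow> h u = (\<Sum>w\<in>S. r u w * h w)"
    and uw: "u \<in> S" "w \<in> S"
  shows "W u * r u w * (h u - h w)\<^sup>2 \<le> 2 * (W b * (\<Sum>w\<in>S. r b w * h w))"
proof -
  have nn: "0 \<le> W u * r u w * (h u - h w)\<^sup>2" if "u \<in> S" "w \<in> S" for u w
    using weight_pos[of u] kernel_nonneg[of u w] that by simp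
  have "W u * r u w * (h u - h w)\<^sup>2 \<le> (\<Sum>w\<in>S. W u * r u w * (h u - h w)\<^sup>2)"
    using uw nn finite_states by (intro member_le_sum) auto
  also have "\<dots> \<le> (\<Sum>u\<in>S. \<Sum>w\<in>S. W u * r u w * (h u - h w)\<^sup>2)"
    using uw nn finite_states
    by (intro member_le_sum[where f = "\<lambda>u. \<Sum>w\<in>S. W u * r u w * (h u - h w)\<^sup>2"]) (auto intro!: sum_nonneg)
  also have "\<dots> = 2 * (W b * (\<Sum>w\<in>S. r b w * h w))"
    by (rule dirichlet_energy_eq[OF ab h harm])
  finally show ?thesis .
qed

end

section \<open>Chains graded by an Ehrenfest chain\<close>

text \<open>Both products count the edges of the \<open>N\<close>-cube between levels
  \<open>j\<close> and \<open>j + 1\<close>, first from above, then from below.\<close>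

lemma absorption_choose_pred:
  assumes "j < N"
  shows "real (Suc j) * real (N choose Suc j) = real N * real ((N - 1) choose j)"
    "real (N - j) * real (N choose j) = real N * real ((N - 1) choose j)"
proof -
  obtain M where M: "N = Suc M" using assms by (cases N) auto
  have "Suc j * (N choose Suc j) = N * (M choose j)"
    unfolding M by (rule Suc_times_binomial)
  then show "real (Suc j) * real (N choose Suc j) = real N * real ((N - 1) choose j)"
    by (metis M diff_Suc_1 of_nat_mult)
  have "(N - j) * (N choose j) = N * ((N - 1) choose j)"
    by (rule binomial_absorb_comp)
  then show "real (N - j) * real (N choose j) = real N * real ((N - 1) choose j)"
    by (metis of_nat_mult)
qed

text \<open>The grade alone moves as an Ehrenfest urn with \<open>N\<close> balls. Normalising the
  weight at \<open>base\<close> makes the level weights binomial coefficients.\<close>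

locale ehrenfest_graded_chain = reversible_chain +
  fixes D :: "'a \<Rightarrow> nat" and N :: nat and base :: 'a
  assumes level_row_sum: "\<And>u j. u \<in> S \<Longrightarrow> (\<Sum>w\<in>{w\<in>S. D w = j}. r u w) =
      (if j = Suc (D u) then real (N - D u) / real N else if D u = Suc j then real (D u) / real N else 0)"
    and bottom_level: "{u\<in>S. D u = 0} = {base}"
    and bottom_weight: "W base = 1"
    and N_pos: "0 < N"
begin

text \<open>Unnormalised: division by \<open>N choose j\<close> gives the conditional mean
  \<open>H\<^sub>j\<close> when \<open>f = h\<close>.\<close>

definition level_sum :: "('a \<Rightarrow> real) \<Rightarrow> nat \<Rightarrow> real" where
  "level_sum f j = (\<Sum>u\<in>{u\<in>S. D u = j}. W u * f u)"

lemma level_sum_0: "level_sum f 0 = f base"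
  by (simp add: level_sum_def bottom_level bottom_weight)

text \<open>By detailed balance, the kernel leaving level \<open>j\<close> becomes the mass sent
  into level \<open>j\<close> from the levels \<open>j - 1\<close> and \<open>j + 1\<close>. The
  case \<open>j = 0\<close> is separate because truncated subtraction would make level 0 its own
  lower neighbour.\<close>

lemma level_sum_kernel:
  "level_sum (\<lambda>u. \<Sum>w\<in>S. r u w * f w) j =
    (if j = 0 then 0 else real (N - (j - 1)) / real N * level_sum f (j - 1)) +
    real (Suc j) / real N * level_sum f (Suc j)"
proof -
  have "level_sum (\<lambda>u. \<Sum>w\<in>S. r u w * f w) j
      = (\<Sum>w\<in>S. W w * f w * (\<Sum>u\<in>{u\<in>S. D u = j}. r w u))"
    unfolding level_sum_def by (rule sum_weight_kernel_swap) auto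
  also have "\<dots> = (\<Sum>w\<in>S. (if j = Suc (D w) then real (N - (j - 1)) / real N * (W w * f w) else 0)
       + (if D w = Suc j then real (Suc j) / real N * (W w * f w) else 0))"
    by (intro sum.cong) (auto simp: level_row_sum)
  also have "\<dots> = (\<Sum>w\<in>{w\<in>S. j = Suc (D w)}. real (N - (j - 1)) / real N * (W w * f w))
      + (\<Sum>w\<in>{w\<in>S. D w = Suc j}. real (Suc j) / real N * (W w * f w))"
    by (simp only: sum.distrib sum.inter_filter[OF finite_states])
  also have "{w\<in>S. j = Suc (D w)} = (if j = 0 then {} else {w\<in>S. D w = j - 1})" by auto
  finally show ?thesis by (simp add: level_sum_def sum_distrib_left)
qed

text \<open>Harmonicity on a level equates the net flow through the gaps below and above it, so
  every flow equals the one leaving \<open>base\<close>, where \<open>f\<close> vanishes.\<close>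

lemma level_sum_flow_constant:
  assumes "\<And>u. u \<in> S \<Longrightarrow> 0 < D u \<Longrightarrow> D u < m \<Longrightarrow> f u = (\<Sum>w\<in>S. r u w * f w)" "f base = 0"
    and "j < m" "m \<le> N"
  shows "real (Suc j) * level_sum f (Suc j) - real (N - j) * level_sum f j
    = real N * (\<Sum>w\<in>S. r base w * f w)"
  using assms(3)
proof (induction j)
  case 0
  have "level_sum (\<lambda>u. \<Sum>w\<in>S. r u w * f w) 0 = 1 / real N * level_sum f 1"
    by (simp add: level_sum_kernel)
  then show ?case using N_pos by (simp add: level_sum_0 assms field_simps)
next
  case (Suc j)
  have "level_sum f (Suc j) = level_sum (\<lambda>u. \<Sum>w\<in>S. r u w * f w) (Suc j)"
    unfolding level_sum_def using assms(1) Suc.prems by (intro sum.cong) auto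
  also have "\<dots> = real (N - j) / real N * level_sum f j
      + real (Suc (Suc j)) / real N * level_sum f (Suc (Suc j))"
    by (simp add: level_sum_kernel)
  finally have "real N * level_sum f (Suc j) = real (N - j) * level_sum f j
      + real (Suc (Suc j)) * level_sum f (Suc (Suc j))"
    using N_pos by (simp add: field_simps)
  moreover have "real (N - Suc j) = real N - real (Suc j)"
    using Suc.prems assms(4) by (intro of_nat_diff) auto
  ultimately show ?case using Suc by (simp add: algebra_simps)
qed

text \<open>The kernel preserves the constant 1, so the level weights obey the three-term recursion
  of \<open>level_sum_kernel\<close>, which the binomial coefficients solve too.\<close>

lemma level_weight: "j \<le> N \<Longrightarrow> level_sum (\<lambda>u. 1) j = real (N choose j)"
proof (induction j rule: less_induct)
  case (less j)
  show ?case
  proof (cases j)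
    case 0
    then show ?thesis by (simp add: level_sum_0)
  next
    case (Suc i)
    have eq: "level_sum (\<lambda>u. 1) i = level_sum (\<lambda>u. \<Sum>w\<in>S. r u w * 1) i"
      unfolding level_sum_def by (intro sum.cong) (auto simp: kernel_row_sum)
    have "real (Suc i) * level_sum (\<lambda>u. 1) (Suc i) = real (N - i) * real (N choose i)"
    proof (cases i)
      case 0
      then show ?thesis using eq N_pos less.prems Suc
        unfolding level_sum_kernel by (simp add: level_sum_0)
    next
      case (Suc l)
      have "real (Suc l) * real (N choose Suc l) = real (N - l) * real (N choose l)"
        using absorption_choose_pred[of l] less.prems \<open>j = Suc i\<close> Suc by simp
      moreover have "level_sum (\<lambda>u. 1) i = real (N choose i)" "level_sum (\<lambda>u. 1) l = real (N choose l)"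
        using less Suc \<open>j = Suc i\<close> by auto
      moreover have "real N * level_sum (\<lambda>u. 1) i = real (N - l) * level_sum (\<lambda>u. 1) l
          + real (Suc i) * level_sum (\<lambda>u. 1) (Suc i)"
        using eq N_pos unfolding level_sum_kernel Suc by (simp add: field_simps)
      moreover have "real (N - i) = real N - real (Suc l)"
        using less.prems Suc \<open>j = Suc i\<close> by simp
      ultimately show ?thesis using Suc by (simp add: algebra_simps)
    qed
    also have "\<dots> = real (Suc i) * real (N choose Suc i)"
      using absorption_choose_pred[of i] less.prems Suc by simp
    finally show ?thesis using Suc by simp
  qed
qed

text \<open>The mean grows from level \<open>j\<close> to \<open>j + 1\<close> by the constant flow
  \<open>N * P\<close> divided by the edge count \<open>c\<close>, that is by
  \<open>P / (N - 1 choose j)\<close>; these increments telescope.\<close>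

lemma level_mean_eq:
  assumes harm: "\<And>u. u \<in> S \<Longrightarrow> 0 < D u \<Longrightarrow> D u < m \<Longrightarrow> f u = (\<Sum>w\<in>S. r u w * f w)" "f base = 0"
    and "m \<le> N"
  shows "j \<le> m \<Longrightarrow> level_sum f j / real (N choose j)
    = (\<Sum>w\<in>S. r base w * f w) * (\<Sum>i<j. 1 / real ((N - 1) choose i))"
proof (induction j)
  case 0
  then show ?case by (simp add: level_sum_0 harm)
next
  case (Suc j)
  define P where "P = (\<Sum>w\<in>S. r base w * f w)"
  define c where "c = real N * real ((N - 1) choose j)"
  have jN: "j < N" using Suc.prems assms by simp
  have c: "c > 0" using jN by (simp add: c_def zero_less_binomial_iff)
  have flow: "real (Suc j) * level_sum f (Suc j) - real (N - j) * level_sum f j = real N * P"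
    using level_sum_flow_constant[OF harm] Suc.prems assms(3) P_def by simp
  have 1: "level_sum f (Suc j) / real (N choose Suc j) = real (Suc j) * level_sum f (Suc j) / c"
    unfolding c_def absorption_choose_pred(1)[OF jN, symmetric] by simp
  have 2: "level_sum f j / real (N choose j) = real (N - j) * level_sum f j / c"
    unfolding c_def absorption_choose_pred(2)[OF jN, symmetric] using jN by simp
  have "level_sum f (Suc j) / real (N choose Suc j) - level_sum f j / real (N choose j) = real N * P / c"
    unfolding 1 2 using flow by (simp add: diff_divide_distrib[symmetric])
  also have "\<dots> = P / real ((N - 1) choose j)"
    using jN by (simp add: c_def)
  finally show ?case using Suc by (simp add: P_def algebra_simps)
qed

text \<open>\<open>W u * f u\<close> is at most \<open>B * sqrt (W u)\<close>, and a single state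
  weighs no more than its level, \<open>N choose m\<close>. The size of the level is bounded crudely
  by \<open>card S\<close>.\<close>

lemma level_sum_le_of_inverse_sqrt:
  assumes "m \<le> N" "0 \<le> B" and le: "\<And>u. u \<in> S \<Longrightarrow> D u = m \<Longrightarrow> f u \<le> B / sqrt (W u)"
  shows "level_sum f m / real (N choose m) \<le> real (card S) * B / sqrt (real (N choose m))"
proof -
  define c where "c = real (N choose m)"
  have c: "c > 0" using assms by (simp add: c_def)
  have "level_sum f m \<le> (\<Sum>u\<in>{u\<in>S. D u = m}. B * sqrt c)"
    unfolding level_sum_def
  proof (rule sum_mono)
    fix u assume u: "u \<in> {u\<in>S. D u = m}"
    then have pos: "W u > 0" using weight_pos by auto
    have "W u * f u \<le> W u * (B / sqrt (W u))"
      using u le pos by (intro mult_left_mono) auto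
    also have "\<dots> = B * sqrt (W u)"
      using pos by (simp add: field_simps)
    also have "W u * 1 \<le> level_sum (\<lambda>u. 1) m"
      unfolding level_sum_def
    proof (rule member_le_sum[OF u])
      show "0 \<le> W v * 1" if "v \<in> {u\<in>S. D u = m} - {u}" for v
        using weight_pos[of v] that by simp
    qed (use finite_states in auto)
    then have "B * sqrt (W u) \<le> B * sqrt c"
      using level_weight[OF assms(1)] assms(2) by (intro mult_left_mono) (auto simp: c_def)
    finally show "W u * f u \<le> B * sqrt c" .
  qed
  also have "\<dots> = real (card {u\<in>S. D u = m}) * (B * sqrt c)" by simp
  also have "\<dots> \<le> real (card S) * (B * sqrt c)"
    using finite_states assms c by (intro mult_right_mono) (auto intro!: card_mono)
  finally have "level_sum f m / c \<le> real (card S) * (B * sqrt c) / c"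
    using c by (intro divide_right_mono) auto
  also have "\<dots> = real (card S) * B / sqrt c"
    using c by (simp add: field_simps)
  finally show ?thesis unfolding c_def .
qed

end

section \<open>The lumped chain in flip-count coordinates\<close>

text \<open>Apart from a tie of the two central ones for odd \<open>n\<close>, binomial coefficients
  strictly increase up to the middle and strictly decrease beyond it, so a mode lies within
  \<open>1 / 2\<close> of \<open>n / 2\<close>.\<close>

lemma binomial_mode_central:
  assumes "\<And>v. v \<le> n \<Longrightarrow> n choose v \<le> n choose z" "z \<le> n"
  shows "2 * z \<le> n + 1" "n \<le> 2 * z + 1"
proof -
  show "n \<le> 2 * z + 1"
  proof (rule ccontr)
    assume "\<not> n \<le> 2 * z + 1"
    then have "n choose z < n choose (n div 2)" by (intro binomial_strict_mono) auto
    with assms(1)[of "n div 2"] show False by simp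
  qed
  show "2 * z \<le> n + 1"
  proof (rule ccontr)
    assume "\<not> 2 * z \<le> n + 1"
    then have "n choose z < n choose (z - 1)" using assms(2) by (intro binomial_strict_antimono) auto
    moreover have "n choose (z - 1) \<le> n choose z" using assms by (intro assms(1)) simp
    ultimately show False by simp
  qed
qed

lemma binomial_step_down_to_central:
  assumes "n \<le> 2 * z + 1" "z < u" "u \<le> n"
  shows "n choose u \<le> n choose (u - 1)"
  using assms by (intro binomial_antimono) auto

lemma binomial_step_up_to_central:
  assumes "2 * z \<le> n + 1" "u < z" "z \<le> n"
  shows "n choose u \<le> n choose (Suc u)"
proof -
  have "n choose (n - u) \<le> n choose (n - Suc u)"
    using assms by (intro binomial_antimono) auto
  moreover have "n choose (n - u) = n choose u" "n choose (n - Suc u) = n choose (Suc u)"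
    using assms by (auto intro!: binomial_symmetric[symmetric])
  ultimately show ?thesis by simp
qed

section \<open>The chain of flip counts, its weight and its level\<close>

locale class_sizes =
  fixes d N :: nat and n :: "nat \<Rightarrow> nat"
  assumes sum_sizes: "(\<Sum>k<d. n k) = N" and size_pos: "\<And>k. k < d \<Longrightarrow> 0 < n k" and N_pos: "0 < N"
begin

text \<open>Coordinate \<open>k\<close> counts the spins of class \<open>k\<close> that differ from
  the starting corner. Every corner thus becomes the zero vector, and one model serves all of
  them.\<close>

definition states :: "(nat \<Rightarrow> nat) set" where
  "states = {v. (\<forall>k<d. v k \<le> n k) \<and> (\<forall>k\<ge>d. v k = 0)}"

text \<open>Each single spin flips with probability \<open>1 / N\<close>. On \<open>states\<close>,
  a move out of the box and the truncated move \<open>u k - 1\<close> at \<open>u k = 0\<close> get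
  coefficient 0.\<close>

definition kern :: "(nat \<Rightarrow> nat) \<Rightarrow> (nat \<Rightarrow> nat) \<Rightarrow> real" where
  "kern u w = (\<Sum>k<d. (if w = u(k := Suc (u k)) then real (n k - u k) / real N else 0)
     + (if w = u(k := u k - 1) then real (u k) / real N else 0))"

text \<open>The number of spin configurations with these counts: the invariant measure, scaled to
  give the corner weight 1.\<close>

definition weight :: "(nat \<Rightarrow> nat) \<Rightarrow> real" where
  "weight v = (\<Prod>k<d. real (n k choose v k))"

text \<open>The Hamming distance from the corner.\<close>

definition level :: "(nat \<Rightarrow> nat) \<Rightarrow> nat" where
  "level v = (\<Sum>k<d. v k)"

text \<open>The l1 distance, which bounds the length of the path to the maximum.\<close>

definition flips :: "(nat \<Rightarrow> nat) \<Rightarrow> (nat \<Rightarrow> nat) \<Rightarrow> nat" where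
  "flips u v = (\<Sum>k<d. nat \<bar>int (u k) - int (v k)\<bar>)"

lemma zero_in_states: "(\<lambda>k. 0) \<in> states"
  by (simp add: states_def)

lemma size_le_N: "k < d \<Longrightarrow> n k \<le> N"
  unfolding sum_sizes[symmetric] by (intro member_le_sum) auto

lemma states_card: "finite states \<and> card states \<le> (N + 1) ^ d"
proof -
  let ?L = "{xs :: nat list. set xs \<subseteq> {..N} \<and> length xs = d}"
  have inj: "inj_on (\<lambda>v. map v [0..<d]) states"
  proof (rule inj_onI)
    fix v w assume vw: "v \<in> states" "w \<in> states" "map v [0..<d] = map w [0..<d]"
    show "v = w"
    proof
      fix k show "v k = w k"
        using vw by (cases "k < d") (auto simp: states_def)
    qed
  qed
  have sub: "(\<lambda>v. map v [0..<d]) ` states \<subseteq> ?L"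
    using size_le_N by (fastforce simp: states_def)
  have fin: "finite ?L" by (rule finite_lists_length_eq) simp
  have "card states = card ((\<lambda>v. map v [0..<d]) ` states)"
    using inj by (simp add: card_image)
  also have "\<dots> \<le> card ?L" using fin sub by (rule card_mono)
  finally show ?thesis
    using finite_imageD[OF finite_subset[OF sub fin] inj] by (simp add: card_lists_length_eq)
qed

lemma level_upd: "k < d \<Longrightarrow> level (v(k := a)) + v k = level v + a"
proof -
  assume k: "k < d"
  have "level w = w k + (\<Sum>j\<in>{..<d} - {k}. w j)" for w
    unfolding level_def using k by (simp add: sum.remove)
  from this[of v] this[of "v(k := a)"] show ?thesis by simp
qed

lemma weight_upd: "k < d \<Longrightarrow> weight (v(k := a)) * real (n k choose v k) = weight v * real (n k choose a)"
proof -
  assume k: "k < d"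
  have "weight w = real (n k choose w k) * (\<Prod>j\<in>{..<d} - {k}. real (n j choose w j))" for w
    unfolding weight_def using k by (simp add: prod.remove)
  from this[of v] this[of "v(k := a)"] show ?thesis by simp
qed

lemma weight_pos: "v \<in> states \<Longrightarrow> 0 < weight v"
  unfolding weight_def states_def by (intro prod_pos) auto

lemma kern_sum:
  assumes u: "u \<in> states"
  shows "(\<Sum>w\<in>states. kern u w * f w) = (\<Sum>k<d. real (n k - u k) / real N * f (u(k := Suc (u k)))
     + real (u k) / real N * f (u(k := u k - 1)))"
proof -
  \<comment> \<open>An upward move at \<open>u k = n k\<close> leaves \<open>states\<close>, so the
    target must be a state or carry coefficient 0.\<close>
  have pick: "(\<Sum>w\<in>states. (if w = t then c else 0) * f w) = c * f t" if "t \<in> states \<or> c = 0" for t c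
  proof -
    have "(\<Sum>w\<in>states. (if w = t then c else 0) * f w) = (\<Sum>w\<in>states. if w = t then c * f t else 0)"
      by (intro sum.cong) auto
    then show ?thesis using that states_card by auto
  qed
  have up: "u(k := Suc (u k)) \<in> states \<or> real (n k - u k) / real N = 0" if "k < d" for k
    using u that by (cases "u k < n k") (auto simp: states_def)
  have down: "u(k := u k - 1) \<in> states" if "k < d" for k
    using u that by (auto simp: states_def intro: le_trans[OF diff_le_self])
  have "(\<Sum>w\<in>states. kern u w * f w) =
     (\<Sum>k<d. (\<Sum>w\<in>states. (if w = u(k := Suc (u k)) then real (n k - u k) / real N else 0) * f w)
     + (\<Sum>w\<in>states. (if w = u(k := u k - 1) then real (u k) / real N else 0) * f w))"
    unfolding kern_def sum_distrib_right sum.distrib[symmetric] by (subst sum.swap) (simp only: distrib_right)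
  also have "\<dots> = (\<Sum>k<d. real (n k - u k) / real N * f (u(k := Suc (u k)))
     + real (u k) / real N * f (u(k := u k - 1)))"
    using up down by (intro sum.cong refl arg_cong2[where f = "(+)"] pick) auto
  finally show ?thesis .
qed

text \<open>Summed over the classes, the rates up and down depend only on the total numbers of
  agreeing and differing spins.\<close>

lemma kern_level_sum:
  assumes u: "u \<in> states"
  shows "(\<Sum>w\<in>{w\<in>states. level w = j}. kern u w) = (if j = Suc (level u) then real (N - level u) / real N
    else if level u = Suc j then real (level u) / real N else 0)"
proof -
  have "(\<Sum>w\<in>{w\<in>states. level w = j}. kern u w) = (\<Sum>w\<in>states. kern u w * (if level w = j then 1 else 0))"
    using states_card by (simp add: sum.inter_filter if_distrib cong: if_cong)
  also have "\<dots> = (\<Sum>k<d. real (n k - u k) / real N * (if j = Suc (level u) then 1 else 0)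
     + real (u k) / real N * (if level u = Suc j then 1 else 0))"
    unfolding kern_sum[OF u]
  proof (intro sum.cong refl arg_cong2[where f = "(+)"])
    fix k assume "k \<in> {..<d}"
    then have k: "k < d" by simp
    show "real (n k - u k) / real N * (if level (u(k := Suc (u k))) = j then 1 else 0)
        = real (n k - u k) / real N * (if j = Suc (level u) then 1 else 0)"
      using level_upd[OF k, of u "Suc (u k)"] by auto
    show "real (u k) / real N * (if level (u(k := u k - 1)) = j then 1 else 0)
        = real (u k) / real N * (if level u = Suc j then 1 else 0)"
      using level_upd[OF k, of u "u k - 1"] by (cases "u k") auto
  qed
  also have "\<dots> = (\<Sum>k<d. real (n k - u k)) / real N * (if j = Suc (level u) then 1 else 0)
     + (\<Sum>k<d. real (u k)) / real N * (if level u = Suc j then 1 else 0)"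
    by (simp add: sum.distrib sum_divide_distrib)
  also have "(\<Sum>k<d. real (n k - u k)) = real (N - level u)"
  proof -
    have "(\<Sum>k<d. n k - u k) = N - level u"
      unfolding sum_sizes[symmetric] level_def using u
      by (intro sum_subtractf_nat) (auto simp: states_def)
    then show ?thesis by (metis of_nat_sum)
  qed
  also have "(\<Sum>k<d. real (u k)) = real (level u)"
    by (simp add: level_def)
  finally show ?thesis by auto
qed

lemma kern_row_sum:
  assumes u: "u \<in> states"
  shows "(\<Sum>w\<in>states. kern u w) = 1"
proof -
  have "(\<Sum>w\<in>states. kern u w) = (\<Sum>k<d. real (n k - u k) / real N + real (u k) / real N)"
    using kern_sum[OF u, of "\<lambda>w. 1"] by simp
  also have "\<dots> = (\<Sum>k<d. real (n k) / real N)"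
  proof (intro sum.cong refl)
    fix k assume "k \<in> {..<d}"
    then have "real (n k - u k) + real (u k) = real (n k)"
      using u by (simp add: states_def)
    then show "real (n k - u k) / real N + real (u k) / real N = real (n k) / real N"
      by (metis add_divide_distrib)
  qed
  also have "\<dots> = real (\<Sum>k<d. n k) / real N" by (simp add: sum_divide_distrib)
  finally show ?thesis using N_pos by (simp add: sum_sizes)
qed

lemma kern_nonneg: "0 \<le> kern u w"
  unfolding kern_def by (intro sum_nonneg add_nonneg_nonneg) simp_all

text \<open>An upward move in class \<open>k\<close> balances its reversal by the absorption
  identities for binomial coefficients. If \<open>u k\<close> exceeds \<open>n k\<close>, both
  weights vanish.\<close>

lemma weight_up_balance:
  assumes "k < d"
  shows "weight u * (if w = u(k := Suc (u k)) then real (n k - u k) / real N else 0)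
    = weight w * (if u = w(k := w k - 1) then real (w k) / real N else 0)"
proof (cases "w = u(k := Suc (u k))")
  case True
  then have u: "u = w(k := w k - 1)" by auto
  have "weight u * real (n k - u k) = weight w * real (w k)"
  proof (cases "u k \<le> n k")
    case le: True
    have "(n k - u k) * (n k choose u k) = Suc (u k) * (n k choose Suc (u k))"
      by (metis binomial_absorb_comp binomial_absorption)
    then have "real (n k - u k) * real (n k choose u k) = real (Suc (u k)) * real (n k choose Suc (u k))"
      by (metis of_nat_mult)
    moreover have "weight w * real (n k choose u k) = weight u * real (n k choose Suc (u k))"
      using weight_upd[OF assms, of u "Suc (u k)"] True by simp
    moreover have "real (n k choose u k) > 0" using le by simp
    ultimately show ?thesis using True
      by (smt (verit) fun_upd_same mult.assoc mult.commute mult_cancel_right)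
  next
    case False
    then have "weight u = 0" "weight w = 0"
      unfolding weight_def using assms True by (auto intro!: prod_zero bexI[of _ k])
    then show ?thesis by simp
  qed
  then show ?thesis
    by (simp only: if_P[OF True] if_P[OF u] times_divide_eq_right)
next
  case False
  \<comment> \<open>Truncated subtraction can make \<open>w\<close> its own lower neighbour, but
    only at \<open>w k = 0\<close>, where the rate is 0.\<close>
  have "u \<noteq> w(k := w k - 1) \<or> w k = 0"
  proof (rule ccontr)
    assume "\<not> (u \<noteq> w(k := w k - 1) \<or> w k = 0)"
    then have "u(k := Suc (u k)) = w" by simp
    with False show False by simp
  qed
  then show ?thesis by (auto simp only: if_not_P[OF False] if_False mult_zero_right of_nat_0 div_0 split: if_split)
qed

lemma kern_detailed_balance: "weight u * kern u w = weight w * kern w u"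
  unfolding kern_def sum_distrib_left distrib_left
proof (intro sum.cong refl)
  fix k assume "k \<in> {..<d}"
  then have k: "k < d" by simp
  show "weight u * (if w = u(k := Suc (u k)) then real (n k - u k) / real N else 0)
      + weight u * (if w = u(k := u k - 1) then real (u k) / real N else 0)
    = weight w * (if u = w(k := Suc (w k)) then real (n k - w k) / real N else 0)
      + weight w * (if u = w(k := w k - 1) then real (w k) / real N else 0)"
    \<comment> \<open>Up from \<open>u\<close> pairs with down from \<open>w\<close> and vice versa,
      hence the exchange of summands.\<close>
    by (rule trans[OF arg_cong2[where f = "(+)"] add.commute])
       (rule weight_up_balance[OF k] weight_up_balance[OF k, symmetric])+
qed

lemma level_zero_iff: "u \<in> states \<Longrightarrow> level u = 0 \<longleftrightarrow> u = (\<lambda>k. 0)"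
proof
  assume "u \<in> states" "level u = 0"
  then have "u k = 0" for k by (cases "k < d") (auto simp: level_def states_def)
  then show "u = (\<lambda>k. 0)" by auto
qed (simp add: level_def)

end

sublocale class_sizes \<subseteq> ehrenfest_graded_chain states kern weight level N "\<lambda>k. 0"
proof
  show "{u \<in> states. level u = 0} = {\<lambda>k. 0}"
    using level_zero_iff zero_in_states by auto
  show "finite states" using states_card by simp
  show "weight (\<lambda>k. 0) = 1" by (simp add: weight_def)
qed (assumption | rule kern_nonneg kern_row_sum weight_pos kern_detailed_balance kern_level_sum N_pos)+

section \<open>Uphill paths to the maximum and the escape bounds\<close>

context class_sizes begin

text \<open>Replacing one coordinate of a maximiser changes a single factor of the product, so each
  coordinate is a binomial mode.\<close>

lemma max_weight_choose_le:
  assumes z: "z \<in> states" and max: "\<And>v. v \<in> states \<Longrightarrow> weight v \<le> weight z" and k: "k < d" "a \<le> n k"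
  shows "n k choose a \<le> n k choose z k"
proof -
  have "weight (z(k := a)) \<le> weight z"
    using z k by (intro max) (auto simp: states_def)
  then have "weight (z(k := a)) * real (n k choose z k) \<le> weight z * real (n k choose z k)"
    by (rule mult_right_mono) simp
  then have "weight z * real (n k choose a) \<le> weight z * real (n k choose z k)"
    unfolding weight_upd[OF k(1)] .
  then show ?thesis using weight_pos[OF z] by simp
qed

lemma max_weight_central:
  assumes z: "z \<in> states" and max: "\<And>v. v \<in> states \<Longrightarrow> weight v \<le> weight z" and k: "k < d"
  shows "2 * z k \<le> n k + 1" "n k \<le> 2 * z k + 1"
proof -
  have "z k \<le> n k" using z k by (simp add: states_def)
  then show "2 * z k \<le> n k + 1" "n k \<le> 2 * z k + 1"
    using binomial_mode_central[OF max_weight_choose_le[OF z max k]] by blast+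
qed

text \<open>Rounding in \<open>n k \<le> 2 * z k + 1\<close> costs at most 1 per class, hence
  \<open>d\<close> in total.\<close>

lemma max_weight_level:
  assumes "z \<in> states" and "\<And>v. v \<in> states \<Longrightarrow> weight v \<le> weight z"
  shows "N \<le> 2 * level z + d"
proof -
  have "N \<le> (\<Sum>k<d. 2 * z k + 1)"
    unfolding sum_sizes[symmetric] using max_weight_central[OF assms] by (intro sum_mono) auto
  also have "\<dots> = 2 * level z + d" unfolding sum.distrib by (simp add: level_def sum_distrib_left)
  finally show ?thesis .
qed

lemma kern_up_ge: "k < d \<Longrightarrow> u k < n k \<Longrightarrow> 1 / real N \<le> kern u (u(k := Suc (u k)))"
proof -
  assume k: "k < d" "u k < n k"
  let ?f = "\<lambda>j. (if u(k := Suc (u k)) = u(j := Suc (u j)) then real (n j - u j) / real N else 0)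
     + (if u(k := Suc (u k)) = u(j := u j - 1) then real (u j) / real N else 0)"
  have "1 / real N \<le> real (n k - u k) / real N" using k by (intro divide_right_mono) auto
  also have "\<dots> \<le> ?f k" by simp
  also have "\<dots> \<le> sum ?f {..<d}" using k by (intro member_le_sum) auto
  finally show ?thesis unfolding kern_def .
qed

lemma kern_down_ge: "k < d \<Longrightarrow> 0 < u k \<Longrightarrow> 1 / real N \<le> kern u (u(k := u k - 1))"
proof -
  assume k: "k < d" "0 < u k"
  let ?f = "\<lambda>j. (if u(k := u k - 1) = u(j := Suc (u j)) then real (n j - u j) / real N else 0)
     + (if u(k := u k - 1) = u(j := u j - 1) then real (u j) / real N else 0)"
  have "1 / real N \<le> real (u k) / real N" using k by (intro divide_right_mono) auto
  also have "\<dots> \<le> ?f k" by simp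
  also have "\<dots> \<le> sum ?f {..<d}" using k by (intro member_le_sum) auto
  finally show ?thesis unfolding kern_def .
qed

text \<open>Moving one wrong coordinate a unit towards \<open>z k\<close> climbs towards a binomial
  mode, so the weight does not drop.\<close>

lemma step_towards_max:
  assumes z: "z \<in> states" and max: "\<And>v. v \<in> states \<Longrightarrow> weight v \<le> weight z"
    and u: "u \<in> states" "u \<noteq> z"
  obtains u' where "u' \<in> states" "weight u \<le> weight u'" "1 / real N \<le> kern u u'"
    "flips u' z < flips u z"
proof -
  obtain k where k: "k < d" "u k \<noteq> z k"
  proof -
    obtain k where "u k \<noteq> z k" using u(2) by auto
    moreover from this have "k < d" using u z by (cases "k < d") (auto simp: states_def)
    ultimately show ?thesis using that by blast
  qed
  have bounds: "u k \<le> n k" "z k \<le> n k" using u z k by (auto simp: states_def)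
  have dist: "flips (u(k := a)) z < flips u z"
    if "\<bar>int a - int (z k)\<bar> < \<bar>int (u k) - int (z k)\<bar>" for a
    unfolding flips_def using that k by (intro sum_strict_mono_ex1) (auto intro!: bexI[of _ k])
  have wt: "weight u \<le> weight (u(k := a))" if "n k choose u k \<le> n k choose a" for a
  proof -
    have "weight u * real (n k choose u k) \<le> weight u * real (n k choose a)"
      using that weight_pos[OF u(1)] by (intro mult_left_mono) auto
    also have "\<dots> = weight (u(k := a)) * real (n k choose u k)"
      using weight_upd[OF k(1)] by simp
    finally show ?thesis using bounds by simp
  qed
  show ?thesis
  proof (cases "u k < z k")
    case True
    show ?thesis
    proof (rule that)
      show "u(k := Suc (u k)) \<in> states" using u True bounds k by (auto simp: states_def)
      show "weight u \<le> weight (u(k := Suc (u k)))"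
        by (intro wt binomial_step_up_to_central[OF max_weight_central(1)[OF z max k(1)] True bounds(2)])
      show "1 / real N \<le> kern u (u(k := Suc (u k)))" using kern_up_ge k True bounds by auto
    qed (use True in \<open>auto intro!: dist\<close>)
  next
    case False
    then have less: "z k < u k" using k by simp
    show ?thesis
    proof (rule that)
      show "u(k := u k - 1) \<in> states" using u bounds k by (auto simp: states_def)
      show "weight u \<le> weight (u(k := u k - 1))"
        by (intro wt binomial_step_down_to_central[OF max_weight_central(2)[OF z max k(1)] less bounds(1)])
      show "1 / real N \<le> kern u (u(k := u k - 1))" using kern_down_ge k less by auto
    qed (use less in \<open>auto intro!: dist\<close>)
  qed
qed

text \<open>Induction on the distance to \<open>z\<close>. Weights along the uphill path stay at
  least \<open>W0\<close> and rates at least \<open>1 / N\<close>, so \<open>edge\<close> bounds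
  each increment by \<open>sqrt (2 * N / W0)\<close>. Fixing \<open>W0\<close> in advance keeps this
  bound the same while \<open>u\<close> moves.\<close>

lemma path_bound_to_max:
  assumes z: "z \<in> states" and max: "\<And>v. v \<in> states \<Longrightarrow> weight v \<le> weight z"
    and edge: "\<And>u w. u \<in> states \<Longrightarrow> w \<in> states \<Longrightarrow> weight u * kern u w * (h u - h w)\<^sup>2 \<le> 2"
    and W0: "0 < W0"
  shows "u \<in> states \<Longrightarrow> W0 \<le> weight u \<Longrightarrow>
    h z - h u \<le> real (flips u z) * sqrt (2 * real N / W0)"
proof (induction "flips u z" arbitrary: u rule: less_induct)
  case less
  show ?case
  proof (cases "u = z")
    case False
    obtain v where v: "v \<in> states" "weight u \<le> weight v" "1 / real N \<le> kern u v"
      and lt: "flips v z < flips u z"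
      using step_towards_max[OF z max less.prems(1) False] by blast
    let ?s = "sqrt (2 * real N / W0)"
    have "W0 * (1 / real N) * (h u - h v)\<^sup>2 \<le> weight u * kern u v * (h u - h v)\<^sup>2"
      using v less.prems W0 by (intro mult_right_mono mult_mono) auto
    also have "\<dots> \<le> 2" using edge less.prems v by simp
    finally have "(h v - h u)\<^sup>2 \<le> 2 * real N / W0"
      using W0 N_pos by (simp add: field_simps power2_commute)
    then have "h v - h u \<le> ?s" by (rule real_le_rsqrt)
    moreover have "h z - h v \<le> real (flips v z) * ?s"
      using less.hyps[OF lt] v less.prems by simp
    moreover have "(real (flips v z) + 1) * ?s
        \<le> real (flips u z) * ?s"
      using lt W0 by (intro mult_right_mono) auto
    ultimately show ?thesis by (simp add: distrib_right)
  qed (use W0 in simp)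
qed

lemma flips_le_N:
  assumes "u \<in> states" "z \<in> states"
  shows "flips u z \<le> N"
  unfolding sum_sizes[symmetric] flips_def
proof (rule sum_mono)
  fix k assume "k \<in> {..<d}"
  then have "u k \<le> n k" "z k \<le> n k" using assms by (simp_all add: states_def)
  then show "nat \<bar>int (u k) - int (z k)\<bar> \<le> n k" by linarith
qed

lemma escape_probability_bounds:
  assumes z: "z \<in> states" "z \<noteq> (\<lambda>k. 0)" and max: "\<And>v. v \<in> states \<Longrightarrow> weight v \<le> weight z"
    and h: "\<And>u. u \<in> states \<Longrightarrow> 0 \<le> h u \<and> h u \<le> 1" "h z = 1" "h (\<lambda>k. 0) = 0"
    and harm: "\<And>u. u \<in> states \<Longrightarrow> u \<noteq> z \<Longrightarrow> u \<noteq> (\<lambda>k. 0) \<Longrightarrow> h u = (\<Sum>w\<in>states. kern u w * h w)"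
    and m: "2 \<le> m" "m \<le> level z" "m \<le> N"
  defines "P \<equiv> \<Sum>w\<in>states. kern (\<lambda>k. 0) w * h w"
  shows "P \<le> 1 - 1 / real N"
    and "1 - real ((N + 1) ^ d) * (real N * sqrt (2 * real N)) / sqrt (real (N choose m))
      \<le> P * (\<Sum>i<m. 1 / real ((N - 1) choose i))"
proof -
  \<comment> \<open>A state below level \<open>m\<close> is not \<open>z\<close>, whose level is at
    least \<open>m\<close>, and positive level excludes the corner.\<close>
  have harm': "h u = (\<Sum>w\<in>states. kern u w * h w)" if "u \<in> states" "0 < level u" "level u < m" for u
    using that m harm level_zero_iff by (metis linorder_not_less less_not_refl)
  have mean: "level_sum h j / real (N choose j) = P * (\<Sum>i<j. 1 / real ((N - 1) choose i))" if "j \<le> m" for j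
    unfolding P_def by (rule level_mean_eq[OF harm' h(3) m(3) that])
  have level_le: "level_sum h j \<le> real (N choose j)" if "j \<le> N" for j
  proof -
    have "level_sum h j \<le> level_sum (\<lambda>u. 1) j"
      unfolding level_sum_def using h weight_pos
      by (intro sum_mono mult_left_mono) (auto intro: less_imp_le)
    then show ?thesis using level_weight[OF that] by simp
  qed
  have P1: "P \<le> 1"
  proof -
    have "P = level_sum h 1 / real N" using mean[of 1] m by simp
    also have "\<dots> \<le> 1" using level_le[of 1] N_pos by simp
    finally show ?thesis .
  qed
  \<comment> \<open>At level 2 the sum is \<open>1 + 1 / (N - 1) = N / (N - 1)\<close>, and the mean
    is at most 1; this is the upper bound.\<close>
  have "P * (1 + 1 / real (N - 1)) = P * (\<Sum>i<2. 1 / real ((N - 1) choose i))"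
    by (simp add: numeral_2_eq_2)
  also have "\<dots> = level_sum h 2 / real (N choose 2)" using mean[of 2] m by simp
  also have "\<dots> \<le> 1"
    using level_le[of 2] m by (intro divide_le_eq_1_pos[THEN iffD2]) auto
  finally have "P * (1 + 1 / real (N - 1)) \<le> 1" .
  moreover have "1 + 1 / real (N - 1) = real N / real (N - 1)"
    using m by (simp add: field_simps of_nat_diff)
  ultimately show "P \<le> 1 - 1 / real N"
    using m by (simp add: field_simps of_nat_diff)

  \<comment> \<open>The corner has weight 1, so the energy is \<open>2 * P\<close>, at most
    2.\<close>
  have edge: "weight u * kern u w * (h u - h w)\<^sup>2 \<le> 2" if "u \<in> states" "w \<in> states" for u w
  proof -
    have "weight u * kern u w * (h u - h w)\<^sup>2
        \<le> 2 * (weight (\<lambda>k. 0) * (\<Sum>w\<in>states. kern (\<lambda>k. 0) w * h w))"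
      using potential_edge_bound[OF z(1) zero_in_states z(2) h(2,3) harm that] by blast
    also have "\<dots> \<le> 2" using P1 by (simp add: P_def bottom_weight)
    finally show ?thesis .
  qed
  have "1 - h u \<le> real N * sqrt (2 * real N) / sqrt (weight u)" if u: "u \<in> states" for u
  proof -
    have "1 - h u \<le> real (flips u z) * sqrt (2 * real N / weight u)"
      using path_bound_to_max[OF z(1) max edge weight_pos[OF u] u] h by simp
    also have "\<dots> \<le> real N * sqrt (2 * real N / weight u)"
      using flips_le_N[OF u z(1)] weight_pos[OF u] by (intro mult_right_mono) auto
    finally show ?thesis by (simp add: real_sqrt_divide)
  qed
  then have "level_sum (\<lambda>u. 1 - h u) m / real (N choose m)
      \<le> real (card states) * (real N * sqrt (2 * real N)) / sqrt (real (N choose m))"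
    using m by (intro level_sum_le_of_inverse_sqrt) auto
  also have "\<dots> \<le> real ((N + 1) ^ d) * (real N * sqrt (2 * real N)) / sqrt (real (N choose m))"
    using states_card by (intro divide_right_mono mult_right_mono) (auto simp del: of_nat_power)
  also have "level_sum (\<lambda>u. 1 - h u) m = real (N choose m) - level_sum h m"
    using level_weight[OF m(3)] by (simp add: level_sum_def algebra_simps sum_subtractf)
  finally have "1 - level_sum h m / real (N choose m)
      \<le> real ((N + 1) ^ d) * (real N * sqrt (2 * real N)) / sqrt (real (N choose m))"
    using m by (simp add: diff_divide_distrib)
  then show "1 - real ((N + 1) ^ d) * (real N * sqrt (2 * real N)) / sqrt (real (N choose m))
      \<le> P * (\<Sum>i<m. 1 / real ((N - 1) choose i))"
    using mean[of m] by simp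
qed

end

section \<open>Transfer to the chain on Gamma\<close>

lemma class_sizes_partition:
  assumes "is_partition N d lab" "0 < d"
  shows "class_sizes d N (cls_size N lab)"
proof
  let ?C = "\<lambda>k. {i. i < N \<and> lab i = k}"
  have "{..<N} = (\<Union>k\<in>{..<d}. ?C k)"
    using assms by (auto simp: is_partition_def)
  moreover have "card (\<Union>k\<in>{..<d}. ?C k) = (\<Sum>k<d. card (?C k))"
    by (rule card_UN_disjoint) auto
  ultimately show "(\<Sum>k<d. cls_size N lab k) = N"
    unfolding cls_size_def by (metis card_lessThan)
  show "0 < cls_size N lab k" if "k < d" for k
    using assms that unfolding cls_size_def is_partition_def by (fastforce simp: card_gt_0_iff)
  show "0 < N" using assms by (auto simp: is_partition_def)
qed

text \<open>\<open>v k\<close> counts the spins of class \<open>k\<close> that differ from the corner \<open>x\<close>.\<close>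
definition flip_point :: "(nat \<Rightarrow> nat) \<Rightarrow> (nat \<Rightarrow> real) \<Rightarrow> (nat \<Rightarrow> nat) \<Rightarrow> nat \<Rightarrow> real" where
  "flip_point n x v = (\<lambda>k. x k * (1 - 2 * real (v k) / real (n k)))"

text \<open>A spin of class \<open>k\<close> is \<open>x k\<close>, minus \<open>2 * x k\<close> if
  it disagrees with the corner.\<close>

lemma gamma_eq_flip_point:
  assumes "x \<in> cube d" and spins: "\<forall>i<N. \<sigma> i \<in> {-1, 1}" and pos: "\<And>k. k < d \<Longrightarrow> 0 < cls_size N lab k"
    and v: "\<And>k. k < d \<Longrightarrow> v k = card {i. i < N \<and> lab i = k \<and> \<sigma> i \<noteq> x k}"
  shows "gamma N d lab \<sigma> = flip_point (cls_size N lab) x v"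
proof
  fix k
  show "gamma N d lab \<sigma> k = flip_point (cls_size N lab) x v k"
  proof (cases "k < d")
    case False
    then show ?thesis using assms(1) by (simp add: gamma_def flip_point_def cube_def)
  next
    case True
    let ?C = "{i. i < N \<and> lab i = k}"
    have x: "x k \<in> {-1, 1}" using assms(1) True by (simp add: cube_def)
    have "(\<Sum>i\<in>?C. \<sigma> i) = (\<Sum>i\<in>?C. x k - (if \<sigma> i \<noteq> x k then 2 * x k else 0))"
      using spins x by (intro sum.cong) auto
    also have "\<dots> = real (card ?C) * x k - (\<Sum>i\<in>{i\<in>?C. \<sigma> i \<noteq> x k}. 2 * x k)"
    proof -
      have fin: "finite ?C" by simp
      show ?thesis
        by (simp only: sum_subtractf sum.inter_filter[OF fin] sum_constant[where A = ?C])
    qed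
    also have "{i\<in>?C. \<sigma> i \<noteq> x k} = {i. i < N \<and> lab i = k \<and> \<sigma> i \<noteq> x k}" by auto
    finally have "(\<Sum>i\<in>?C. \<sigma> i) = x k * (real (cls_size N lab k) - 2 * real (v k))"
      using v[OF True] by (simp add: cls_size_def algebra_simps)
    then show ?thesis
      using True pos[OF True] by (simp add: gamma_def flip_point_def field_simps)
  qed
qed

lemma Gamma_eq_flip_point_image:
  assumes part: "is_partition N d lab" "0 < d" and x: "x \<in> cube d"
  defines "n \<equiv> cls_size N lab"
  shows "Gamma N d lab = flip_point n x ` class_sizes.states d n"
proof -
  interpret class_sizes d N n unfolding n_def by (rule class_sizes_partition[OF part])
  have pos: "0 < cls_size N lab k" if "k < d" for k using size_pos[OF that] by (simp add: n_def)
  show ?thesis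
  proof (intro set_eqI iffI)
    fix y assume "y \<in> Gamma N d lab"
    then obtain \<sigma> where \<sigma>: "\<forall>i<N. \<sigma> i \<in> {-1, 1}" and y: "y = gamma N d lab \<sigma>"
      by (auto simp: Gamma_def)
    define v where "v k = (if k < d then card {i. i < N \<and> lab i = k \<and> \<sigma> i \<noteq> x k} else 0)" for k
    have "v k \<le> n k" for k
      unfolding v_def n_def cls_size_def by (auto intro!: card_mono)
    moreover have "v k = 0" if "d \<le> k" for k using that by (simp add: v_def)
    ultimately have "v \<in> states" by (simp add: states_def)
    moreover have "y = flip_point n x v"
      unfolding y n_def by (rule gamma_eq_flip_point[OF x \<sigma> pos]) (simp_all add: v_def)
    ultimately show "y \<in> flip_point n x ` states" by simp
  next
    fix y assume "y \<in> flip_point n x ` states"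
    then obtain v where v: "v \<in> states" and y: "y = flip_point n x v" by auto
    have "\<exists>T. T \<subseteq> {i. i < N \<and> lab i = k} \<and> card T = v k" if "k < d" for k
    proof -
      have "v k \<le> n k" using v that by (simp add: states_def)
      then have "v k \<le> card {i. i < N \<and> lab i = k}" by (simp add: n_def cls_size_def)
      then show ?thesis by (metis obtain_subset_with_card_n)
    qed
    then obtain T where T: "\<And>k. k < d \<Longrightarrow> T k \<subseteq> {i. i < N \<and> lab i = k} \<and> card (T k) = v k"
      by metis
    \<comment> \<open>Any count up to the class size is realised by reversing the corner's spins on
      a subset of that size.\<close>
    define \<sigma> where "\<sigma> i = (if i \<in> T (lab i) then - x (lab i) else x (lab i))" for i
    have xk: "x k = -1 \<or> x k = 1" if "k < d" for k using x that by (simp add: cube_def)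
    have \<sigma>: "\<forall>i<N. \<sigma> i \<in> {-1, 1}"
    proof (intro allI impI)
      fix i assume "i < N"
      then have "lab i < d" using part by (simp add: is_partition_def)
      from xk[OF this] show "\<sigma> i \<in> {-1, 1}" by (auto simp: \<sigma>_def)
    qed
    have "v k = card {i. i < N \<and> lab i = k \<and> \<sigma> i \<noteq> x k}" if k: "k < d" for k
    proof -
      have "{i. i < N \<and> lab i = k \<and> \<sigma> i \<noteq> x k} = T k"
        using T[OF k] xk[OF k] by (auto simp: \<sigma>_def)
      then show ?thesis using T[OF k] by simp
    qed
    then have "y = gamma N d lab \<sigma>"
      unfolding y n_def using gamma_eq_flip_point[OF x \<sigma> pos, of v] by simp
    then show "y \<in> Gamma N d lab" using \<sigma> by (auto simp: Gamma_def)
  qed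
qed

text \<open>Corner coordinates are nonzero, so the affine map is injective. It is stated for all
  functions vanishing beyond \<open>d\<close> because the target \<open>u(k := a)\<close> of a move
  may lie outside \<open>states\<close>.\<close>

lemma (in class_sizes) flip_point_eq_iff:
  assumes "x \<in> cube d" "\<And>k. d \<le> k \<Longrightarrow> u k = 0" "\<And>k. d \<le> k \<Longrightarrow> w k = 0"
  shows "flip_point n x u = flip_point n x w \<longleftrightarrow> u = w"
proof
  assume eq: "flip_point n x u = flip_point n x w"
  show "u = w"
  proof
    fix k show "u k = w k"
    proof (cases "k < d")
      case True
      have "x k \<noteq> 0" using assms(1) True by (auto simp: cube_def)
      then have "real (u k) / real (n k) = real (w k) / real (n k)"
        using fun_cong[OF eq, of k] by (simp add: flip_point_def)
      then show ?thesis using size_pos[OF True] by simp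
    qed (use assms in simp)
  qed
qed simp

text \<open>The sign \<open>s = - x k\<close> leads away from the corner and raises the count,
  \<open>s = x k\<close> leads back and lowers it.\<close>

lemma trans_prob_flip_point:
  assumes part: "is_partition N d lab" "0 < d" and x: "x \<in> cube d"
  defines "n \<equiv> cls_size N lab"
  assumes u: "u \<in> class_sizes.states d n" and w: "w \<in> class_sizes.states d n"
  shows "trans_prob N d lab (flip_point n x u) (flip_point n x w) = class_sizes.kern d N n u w"
proof -
  interpret class_sizes d N n unfolding n_def by (rule class_sizes_partition[OF part])
  let ?p = "flip_point n x"
  show ?thesis unfolding trans_prob_def kern_def n_def[symmetric]
  proof (rule sum.cong[OF refl])
    fix k assume "k \<in> {..<d}"
    then have k: "k < d" by simp
    have nk: "0 < n k" and uk: "u k \<le> n k" using size_pos[OF k] u k by (auto simp: states_def)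
    have xk: "x k = -1 \<or> x k = 1" using x k by (simp add: cube_def)
    then have sq: "x k * x k = 1" by auto
    define g where "g s = (if ?p w = (\<lambda>j. ?p u j + s * (2 / real (n k)) * unit_vec k j)
        then real (n k) / real N * (1 - s * ?p u k) / 2 else 0)" for s
    have inj: "?p w = ?p (u(k := a)) \<longleftrightarrow> w = u(k := a)" for a
      using u w k by (intro flip_point_eq_iff[OF x]) (auto simp: states_def)
    have up: "g (- x k) = (if w = u(k := Suc (u k)) then real (n k - u k) / real N else 0)"
    proof -
      have "(\<lambda>j. ?p u j + - x k * (2 / real (n k)) * unit_vec k j) = ?p (u(k := Suc (u k)))"
        using nk by (auto simp: fun_eq_iff flip_point_def unit_vec_def field_simps)
      moreover have "real (n k) / real N * (1 - - x k * ?p u k) / 2 = real (n k - u k) / real N"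
      proof -
        have "1 - - x k * ?p u k = 1 + x k * x k * (1 - 2 * real (u k) / real (n k))"
          by (simp add: flip_point_def)
        also have "\<dots> = 2 * real (n k - u k) / real (n k)"
          unfolding sq using nk uk by (simp add: field_simps of_nat_diff)
        finally show ?thesis using nk by simp
      qed
      ultimately show ?thesis unfolding g_def by (simp only: inj)
    qed
    have down: "g (x k) = (if w = u(k := u k - 1) then real (u k) / real N else 0)"
    proof -
      have val: "real (n k) / real N * (1 - x k * ?p u k) / 2 = real (u k) / real N"
      proof -
        have "1 - x k * ?p u k = 1 - x k * x k * (1 - 2 * real (u k) / real (n k))"
          by (simp add: flip_point_def)
        also have "\<dots> = 2 * real (u k) / real (n k)" unfolding sq by simp
        finally show ?thesis using nk by simp
      qed
      show ?thesis
      \<comment> \<open>At \<open>u k = 0\<close> the two targets differ: one overshoots the corner,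
        the truncated one is \<open>u\<close> itself. Both carry rate 0.\<close>
      proof (cases "u k = 0")
        case True
        then show ?thesis unfolding g_def val by simp
      next
        case False
        then have "real (u k - 1) = real (u k) - 1" by simp
        then have "(\<lambda>j. ?p u j + x k * (2 / real (n k)) * unit_vec k j) = ?p (u(k := u k - 1))"
          using nk by (auto simp: fun_eq_iff flip_point_def unit_vec_def field_simps)
        then show ?thesis unfolding g_def val by (simp only: inj)
      qed
    qed
    have "(\<Sum>s\<in>{-1, 1}. g s) = g (- x k) + g (x k)" using xk by auto
    then show "(\<Sum>s\<in>{-1, 1}. if ?p w = (\<lambda>j. ?p u j + s * (2 / real (n k)) * unit_vec k j)
        then real (n k) / real N * (1 - s * ?p u k) / 2 else 0)
      = (if w = u(k := Suc (u k)) then real (n k - u k) / real N else 0)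
        + (if w = u(k := u k - 1) then real (u k) / real N else 0)"
      unfolding up down unfolding g_def .
  qed
qed

text \<open>The lower binomial argument counts the spins equal to 1: \<open>v k\<close> if
  \<open>x k = -1\<close>, and \<open>n k - v k\<close> if \<open>x k = 1\<close>, where symmetry
  applies.\<close>

lemma QN_flip_point:
  assumes part: "is_partition N d lab" "0 < d" and x: "x \<in> cube d"
  defines "n \<equiv> cls_size N lab"
  assumes v: "v \<in> class_sizes.states d n"
  shows "QN N d lab (flip_point n x v) = class_sizes.weight d n v / 2 ^ N"
proof -
  interpret class_sizes d N n unfolding n_def by (rule class_sizes_partition[OF part])
  have "n k choose nat (round (real (n k) * (1 + flip_point n x v k) / 2)) = n k choose v k" if k: "k < d" for k
  proof -
    have vk: "v k \<le> n k" and nk: "0 < n k" using v k size_pos by (auto simp: states_def)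
    have "x k = -1 \<or> x k = 1" using x k by (simp add: cube_def)
    then show ?thesis
    proof
      assume "x k = -1"
      then have "real (n k) * (1 + flip_point n x v k) / 2 = real (v k)"
        using nk by (simp add: flip_point_def field_simps)
      then show ?thesis by simp
    next
      assume "x k = 1"
      then have "real (n k) * (1 + flip_point n x v k) / 2 = real (n k - v k)"
        using nk vk by (simp add: flip_point_def field_simps of_nat_diff)
      then show ?thesis using binomial_symmetric[OF vk] by (simp only: round_of_nat nat_int)
    qed
  qed
  then show ?thesis unfolding QN_def weight_def n_def[symmetric] by simp
qed

text \<open>\<open>flip_point\<close> is an isomorphism of chains that sends the zero vector to
  \<open>x\<close> and respects the invariant measure up to a factor, so the bounds
  transfer.\<close>

lemma hit_before_bounds:
  assumes part: "is_partition N d lab" "0 < d" and x: "x \<in> cube d" and z: "z \<in> Gamma N d lab"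
    and max: "\<forall>y\<in>Gamma N d lab. QN N d lab y \<le> QN N d lab z"
    and m: "2 \<le> m" "2 * m + d \<le> N"
  defines "P \<equiv> hit_before (Gamma N d lab) (trans_prob N d lab) x z x"
  shows "P \<le> 1 - 1 / real N"
    and "1 - real ((N + 1) ^ d) * (real N * sqrt (2 * real N)) / sqrt (real (N choose m))
      \<le> P * (\<Sum>i<m. 1 / real ((N - 1) choose i))"
proof -
  define n where "n = cls_size N lab"
  interpret class_sizes d N n unfolding n_def by (rule class_sizes_partition[OF part])
  let ?p = "flip_point n x"
  let ?o = "\<lambda>k. 0 :: nat"
  have Gamma: "Gamma N d lab = ?p ` states"
    unfolding n_def by (rule Gamma_eq_flip_point_image[OF part x])
  have kern: "trans_prob N d lab (?p u) (?p w) = kern u w" if "u \<in> states" "w \<in> states" for u w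
    using trans_prob_flip_point[OF part x] that unfolding n_def by blast
  have inj: "inj_on ?p states"
    by (intro inj_onI) (subst (asm) flip_point_eq_iff[OF x], auto simp: states_def)
  have x_eq: "?p ?o = x" by (simp add: flip_point_def)
  obtain zv where zv: "zv \<in> states" and z_eq: "z = ?p zv" using z Gamma by auto
  have max': "weight v \<le> weight zv" if "v \<in> states" for v
  proof -
    have "QN N d lab (?p v) \<le> QN N d lab (?p zv)" using max that unfolding Gamma z_eq by blast
    then show ?thesis
      using QN_flip_point[OF part x] that zv unfolding n_def by (simp add: divide_le_cancel)
  qed
  \<comment> \<open>Here \<open>2 * m + d \<le> N\<close> meets the bound
    \<open>N \<le> 2 * level zv + d\<close> for a maximiser.\<close>
  have level: "m \<le> level zv" "m \<le> N" using max_weight_level[OF zv max'] m by auto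
  have z0: "zv \<noteq> ?o" using level m by (auto simp: level_def)
  have reindex: "(\<Sum>y\<in>Gamma N d lab. f y) = (\<Sum>v\<in>states. f (?p v))" for f :: "_ \<Rightarrow> real"
    unfolding Gamma using sum.reindex[OF inj] by simp
  interpret G: finite_chain "Gamma N d lab" "trans_prob N d lab"
  proof
    show "finite (Gamma N d lab)" unfolding Gamma using finite_states by simp
    show "0 \<le> trans_prob N d lab u w" if "u \<in> Gamma N d lab" "w \<in> Gamma N d lab" for u w
      using that kern_nonneg unfolding Gamma by (auto simp: kern)
    show "(\<Sum>w\<in>Gamma N d lab. trans_prob N d lab u w) = 1" if "u \<in> Gamma N d lab" for u
      using that kern_row_sum unfolding reindex unfolding Gamma by (auto simp: kern)
  qed
  have xG: "x \<in> Gamma N d lab"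
    using imageI[OF zero_in_states, of ?p] by (simp only: Gamma x_eq)
  have zx: "z \<noteq> x"
    unfolding z_eq using x_eq z0 inj_onD[OF inj _ zv zero_in_states] by auto
  obtain h where h: "\<And>u. u \<in> Gamma N d lab \<Longrightarrow> 0 \<le> h u \<and> h u \<le> 1" "h z = 1" "h x = 0"
    and harm: "\<And>u. u \<in> Gamma N d lab \<Longrightarrow> u \<noteq> z \<Longrightarrow> u \<noteq> x \<Longrightarrow>
      h u = (\<Sum>w\<in>Gamma N d lab. trans_prob N d lab u w * h w)"
    and P: "P = (\<Sum>w\<in>Gamma N d lab. trans_prob N d lab x w * h w)"
    by (rule G.hitting_potential_exists[OF z xG zx, folded P_def]) blast
  define H where "H v = h (?p v)" for v
  have PH: "P = (\<Sum>w\<in>states. kern ?o w * H w)"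
    unfolding P reindex H_def
    by (intro sum.cong refl) (metis kern x_eq zero_in_states)
  have H01: "0 \<le> H v \<and> H v \<le> 1" if "v \<in> states" for v
    unfolding H_def using h(1) that unfolding Gamma by blast
  have Hz: "H zv = 1" and Hx: "H ?o = 0"
    unfolding H_def using h(2,3) z_eq x_eq by auto
  have Hharm: "H u = (\<Sum>w\<in>states. kern u w * H w)" if u: "u \<in> states" "u \<noteq> zv" "u \<noteq> ?o" for u
  proof -
    have "?p u \<noteq> z" "?p u \<noteq> x"
      using inj_onD[OF inj _ u(1) zv] inj_onD[OF inj _ u(1) zero_in_states] u z_eq x_eq by auto
    then have "H u = (\<Sum>w\<in>states. trans_prob N d lab (?p u) (?p w) * H w)"
      unfolding H_def using harm[of "?p u"] u unfolding reindex unfolding Gamma by blast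
    also have "\<dots> = (\<Sum>w\<in>states. kern u w * H w)"
      using u by (intro sum.cong refl) (simp add: kern)
    finally show ?thesis .
  qed
  show "P \<le> 1 - 1 / real N"
    and "1 - real ((N + 1) ^ d) * (real N * sqrt (2 * real N)) / sqrt (real (N choose m))
      \<le> P * (\<Sum>i<m. 1 / real ((N - 1) choose i))"
    unfolding PH
    using escape_probability_bounds[OF zv z0 max' H01 Hz Hx Hharm m(1) level] by blast+
qed

section \<open>Asymptotic estimates\<close>

text \<open>The coefficient 3 is \<open>1 + 2\<close>, from the second-order part of
  \<open>1 / (N - 1)\<close> and the leading part of \<open>1 / (N - 1 choose 2)\<close>. Indices
  from 4 to \<open>m\<close> stay below the middle, so each term is at most the one at 4, and at
  most \<open>N\<close> such terms give order \<open>N^(-3)\<close>.\<close>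

lemma sum_inverse_binomial_le:
  assumes N: "100 \<le> N" and m: "m = N div 4"
  shows "(\<Sum>i<m. 1 / real ((N - 1) choose i)) \<le> 1 + 1 / real N + 3 / real N ^ 2 + 5000 / real N ^ 3"
proof -
  define x where "x = real N"
  have x: "100 \<le> x" using N by (simp add: x_def)
  have M: "real (N - 1) = x - 1" using N by (simp add: x_def of_nat_diff)
  have half: "x / 2 \<le> x - 1" using x by simp
  \<comment> \<open>From \<open>n choose k \<ge> (n / k)^k\<close> and
    \<open>N - 1 \<ge> N / 2\<close>. For \<open>k = 3\<close> and \<open>k = 4\<close> this gives
    the constants \<open>6^3 = 216\<close> and \<open>8^4 = 4096\<close>.\<close>
  have pow: "1 / real ((N - 1) choose k) \<le> (2 * real k) ^ k / x ^ k" if "0 < k" "k \<le> N - 1" for k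
  proof -
    have "(x / (2 * real k)) ^ k \<le> (real (N - 1) / real k) ^ k"
      using x that half M by (intro power_mono) (auto simp: field_simps)
    also have "\<dots> \<le> real ((N - 1) choose k)"
      using binomial_ge_n_over_k_pow_k[OF that(2), where ?'a = real] by simp
    finally have "1 / real ((N - 1) choose k) \<le> 1 / (x / (2 * real k)) ^ k"
      using x that by (intro divide_left_mono) (auto simp: zero_less_binomial_iff)
    then show ?thesis by (simp add: power_divide)
  qed
  have "(\<Sum>i<m. 1 / real ((N - 1) choose i))
      = (\<Sum>i<4. 1 / real ((N - 1) choose i)) + (\<Sum>i\<in>{4..<m}. 1 / real ((N - 1) choose i))"
    using N m by (subst sum.union_disjoint[symmetric]) (auto intro!: sum.cong)
  also have "(\<Sum>i<4. 1 / real ((N - 1) choose i))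
      = 1 + 1 / (x - 1) + 1 / real ((N - 1) choose 2) + 1 / real ((N - 1) choose 3)"
    using M by (simp add: eval_nat_numeral)
  also have "1 / (x - 1) \<le> 1 / x + 1 / x ^ 2 + 2 / x ^ 3"
  proof -
    have "x ^ 3 \<le> (x ^ 2 + x + 2) * (x - 1)"
      using x by (simp add: algebra_simps power2_eq_square power3_eq_cube)
    then have "1 / (x - 1) \<le> (x ^ 2 + x + 2) / x ^ 3"
      using x by (simp add: divide_le_eq pos_le_divide_eq)
    also have "\<dots> = 1 / x + 1 / x ^ 2 + 2 / x ^ 3"
      using x by (simp add: add_divide_distrib power2_eq_square power3_eq_cube)
    finally show ?thesis .
  qed
  also have "1 / real ((N - 1) choose 2) \<le> 2 / x ^ 2 + 12 / x ^ 3"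
  proof -
    have "real ((N - 1) choose 2) = (x - 1) * (x - 2) / 2"
    proof -
      have "even ((N - 1) * (N - 1 - 1))" by simp
      then have "real ((N - 1) * (N - 1 - 1) div 2) = real ((N - 1) * (N - 1 - 1)) / 2"
        by (simp only: real_of_nat_div of_nat_numeral)
      then show ?thesis using N M by (simp add: choose_two of_nat_diff x_def)
    qed
    moreover have "2 * x ^ 3 \<le> (2 * x + 12) * ((x - 1) * (x - 2))"
    proof -
      have "(2 * x + 12) * ((x - 1) * (x - 2)) - 2 * x ^ 3 = x * (6 * x - 32) + 24"
        by (simp add: algebra_simps power3_eq_cube)
      moreover have "0 \<le> x * (6 * x - 32)" using x by (intro mult_nonneg_nonneg) auto
      ultimately show ?thesis by linarith
    qed
    then have "2 / ((x - 1) * (x - 2)) \<le> (2 * x + 12) / x ^ 3"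
      using x by (simp add: divide_le_eq pos_le_divide_eq)
    moreover have "(2 * x + 12) / x ^ 3 = 2 / x ^ 2 + 12 / x ^ 3"
      using x by (simp add: add_divide_distrib power2_eq_square power3_eq_cube)
    moreover have "1 / ((x - 1) * (x - 2) / 2) = 2 / ((x - 1) * (x - 2))" by simp
    ultimately show ?thesis by metis
  qed
  also have "1 / real ((N - 1) choose 3) \<le> 216 / x ^ 3"
    using pow[of 3] N by simp
  also have "(\<Sum>i\<in>{4..<m}. 1 / real ((N - 1) choose i)) \<le> (\<Sum>i\<in>{4..<m}. 4096 / x ^ 4)"
  proof (rule sum_mono)
    fix i assume i: "i \<in> {4..<m}"
    have "(N - 1) choose 4 \<le> (N - 1) choose i"
      using i m by (intro binomial_mono) auto
    then have "1 / real ((N - 1) choose i) \<le> 1 / real ((N - 1) choose 4)"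
      using N i m by (intro divide_left_mono mult_pos_pos) (auto simp: zero_less_binomial_iff)
    also have "\<dots> \<le> 4096 / x ^ 4" using pow[of 4] N by simp
    finally show "1 / real ((N - 1) choose i) \<le> 4096 / x ^ 4" .
  qed
  also have "(\<Sum>i\<in>{4..<m}. 4096 / x ^ 4) \<le> x * (4096 / x ^ 4)"
    using x m by (simp only: sum_constant, intro mult_right_mono) (auto simp: x_def)
  also have "x * (4096 / x ^ 4) = 4096 / x ^ 3"
    using x by (simp add: eval_nat_numeral)
  finally have "(\<Sum>i<m. 1 / real ((N - 1) choose i))
      \<le> 1 + (1 / x + 1 / x ^ 2 + 2 / x ^ 3) + (2 / x ^ 2 + 12 / x ^ 3) + 216 / x ^ 3 + 4096 / x ^ 3"
    by simp
  also have "\<dots> = 1 + 1 / x + 3 * (1 / x ^ 2) + 4326 * (1 / x ^ 3)" by simp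
  also have "\<dots> \<le> 1 + 1 / x + 3 * (1 / x ^ 2) + 5000 * (1 / x ^ 3)"
    using x by (intro add_left_mono mult_right_mono) auto
  finally show ?thesis by (simp add: x_def)
qed

text \<open>The state count is at most \<open>N^(2 * d) \<le> exp (N / 100)\<close>, while
  \<open>sqrt (N choose m)\<close> is at least \<open>2^m \<ge> exp (N / 8) / 2\<close>; the
  exponential gap absorbs the polynomial factor.\<close>

lemma error_term_le:
  assumes N: "100 \<le> N" and d: "real d * ln (real N) \<le> real N / 200" and m: "m = N div 4"
  shows "real ((N + 1) ^ d) * (real N * sqrt (2 * real N)) / sqrt (real (N choose m))
    \<le> 4 * 50 ^ 5 / real N ^ 3"
proof -
  define x where "x = real N"
  have x: "100 \<le> x" using N by (simp add: x_def)
  have "real ((N + 1) ^ d) \<le> (x ^ 2) ^ d"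
  proof -
    have "1 + x \<le> 2 * x" using x by simp
    also have "\<dots> \<le> x * x" using x by (intro mult_right_mono) auto
    finally have "real (N + 1) \<le> x ^ 2" by (simp add: x_def power2_eq_square)
    then show ?thesis unfolding of_nat_power by (intro power_mono) auto
  qed
  also have "\<dots> = exp (2 * (real d * ln x))"
  proof -
    have "(x ^ 2) ^ d = exp (ln x) ^ (2 * d)" using x by (simp add: power_mult)
    then show ?thesis by (simp flip: exp_of_nat_mult add: mult.assoc)
  qed
  also have "\<dots> \<le> exp (x / 100)" using d by (simp add: x_def)
  finally have states: "real ((N + 1) ^ d) \<le> exp (x / 100)" .
  have "sqrt (2 * x) \<le> 2 * x"
    using x by (intro real_le_lsqrt) (auto simp: power2_eq_square)
  then have poly: "x * sqrt (2 * x) \<le> x * (2 * x)" using x by (intro mult_left_mono) auto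
  have "(4::real) ^ m \<le> (real N / real m) ^ m"
    using N m by (intro power_mono) (auto simp: field_simps)
  also have "\<dots> \<le> real (N choose m)"
    using m by (intro binomial_ge_n_over_k_pow_k) simp
  finally have "sqrt (4 ^ m) \<le> sqrt (real (N choose m))" by simp
  moreover have "sqrt (4 ^ m) = (2::real) ^ m" by (simp add: real_sqrt_power)
  moreover have "exp (x / 8) / 2 \<le> (2::real) ^ m"
  proof -
    have half: "exp (1 / 2) \<le> (2::real)"
    proof -
      have "exp (1 / 2) ^ 2 = exp (1::real)" by (simp flip: exp_of_nat_mult)
      also have "\<dots> \<le> 2 ^ 2" using exp_le by simp
      finally show ?thesis by (rule power2_le_imp_le) simp
    qed
    \<comment> \<open>Rounding in \<open>N div 4\<close> loses at most \<open>3 / 4\<close>, halved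
      to \<open>3 / 8\<close>, which the extra \<open>1 / 2\<close> covers.\<close>
    have "x / 8 \<le> real m * (1 / 2) + 1 / 2" using m unfolding x_def by linarith
    then have "exp (x / 8) \<le> exp (real m * (1 / 2) + 1 / 2)" by simp
    also have "\<dots> = exp (1 / 2) ^ m * exp (1 / 2)"
      by (simp only: exp_add exp_of_nat_mult)
    also have "\<dots> \<le> 2 ^ m * 2" using half by (intro mult_mono power_mono) auto
    finally show ?thesis by simp
  qed
  ultimately have binom: "exp (x / 8) / 2 \<le> sqrt (real (N choose m))" by simp
  have "real ((N + 1) ^ d) * (x * sqrt (2 * x)) / sqrt (real (N choose m))
      \<le> exp (x / 100) * (x * (2 * x)) / (exp (x / 8) / 2)"
    using states poly binom x by (intro frac_le mult_mono) auto
  also have "\<dots> = 4 * x ^ 2 * (exp (x / 100) / exp (x / 8))" by (simp add: power2_eq_square)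
  also have "exp (x / 100) / exp (x / 8) = exp (x / 100 - x / 8)" by (simp only: exp_diff)
  also have "\<dots> \<le> exp (- (x / 10))" using x by simp
  \<comment> \<open>The fifth power is chosen so that, times \<open>x^2\<close>, order
    \<open>x^(-3)\<close> remains.\<close>
  also have "\<dots> \<le> 50 ^ 5 / x ^ 5"
  proof -
    have "x / 50 \<le> exp (x / 50)" using exp_ge_add_one_self[of "x / 50"] by linarith
    then have "(x / 50) ^ 5 \<le> exp (x / 50) ^ 5" using x by (intro power_mono) auto
    also have "\<dots> = exp (x / 10)" by (simp flip: exp_of_nat_mult)
    finally have "inverse (exp (x / 10)) \<le> inverse ((x / 50) ^ 5)"
      using x by (intro le_imp_inverse_le) auto
    then show ?thesis by (simp add: exp_minus power_divide)
  qed
  finally have "real ((N + 1) ^ d) * (x * sqrt (2 * x)) / sqrt (real (N choose m))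
      \<le> 4 * x ^ 2 * (50 ^ 5 / x ^ 5)" using x by simp
  also have "\<dots> = 4 * 50 ^ 5 / x ^ 3" using x by (simp add: eval_nat_numeral)
  finally show ?thesis by (simp add: x_def)
qed

section \<open>Combination of the two escape bounds with the asymptotics\<close>

theorem theorem3p1:
  shows "\<exists>\<alpha>0::real. 0 < \<alpha>0 \<and> \<alpha>0 \<le> 1/20 \<and> (\<exists>C::real.
     \<forall>N d lab x z.
       0 < d \<and> real d \<le> \<alpha>0 * real N / ln (real N) \<and> is_partition N d lab \<and>
       x \<in> cube d \<and> z \<in> Gamma N d lab \<and>
       (\<forall>y\<in>Gamma N d lab. QN N d lab y \<le> QN N d lab z) \<longrightarrow>
       0 \<le> (1 - 1 / real N) - hit_before (Gamma N d lab) (trans_prob N d lab) x z x \<and>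
       (1 - 1 / real N) - hit_before (Gamma N d lab) (trans_prob N d lab) x z x
         \<le> 3 / real N ^ 2 * (1 + C / sqrt (real N)))"
\<comment> \<open>\<open>1 / 200\<close> bounds the state count by \<open>exp (N / 100)\<close>; the
  second witness adds the \<open>N^(-3)\<close> constants of the binomial sum and of the error
  term.\<close>
proof (rule exI[of _ "1 / 200"], intro conjI exI[of _ "5000 + 4 * 50 ^ 5"] allI impI)
  fix N d lab x z
  assume "0 < d \<and> real d \<le> 1 / 200 * real N / ln (real N) \<and> is_partition N d lab \<and>
       x \<in> cube d \<and> z \<in> Gamma N d lab \<and>
       (\<forall>y\<in>Gamma N d lab. QN N d lab y \<le> QN N d lab z)"
  then have d: "0 < d" "real d \<le> real N / 200 / ln (real N)" and part: "is_partition N d lab"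
    and x: "x \<in> cube d" and z: "z \<in> Gamma N d lab"
    and max: "\<forall>y\<in>Gamma N d lab. QN N d lab y \<le> QN N d lab z" by auto
  define P where "P = hit_before (Gamma N d lab) (trans_prob N d lab) x z x"
  define m where "m = N div 4"
  define S where "S = (\<Sum>i<m. 1 / real ((N - 1) choose i))"
  define K :: real where "K = 5000 + 4 * 50 ^ 5"
  \<comment> \<open>For \<open>N = 0\<close> and \<open>N = 1\<close> the bound on \<open>d\<close>
    evaluates to 0, in the latter case because division by \<open>ln 1 = 0\<close> gives 0.\<close>
  have "N \<noteq> 0" using d by (cases "N = 0") auto
  moreover have "N \<noteq> 1" using d by (cases "N = 1") auto
  ultimately have N2: "2 \<le> N" by simp
  have "1 / 2 \<le> ln (2::real)" using ln_le_minus_one[of "1 / 2 :: real"] by (simp add: ln_div)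
  also have "ln 2 \<le> ln (real N)" using N2 by simp
  finally have ln: "1 / 2 \<le> ln (real N)" .
  then have dln: "real d * ln (real N) \<le> real N / 200"
    using d(2) by (simp add: pos_le_divide_eq)
  have "real d * (1 / 2) \<le> real d * ln (real N)" using ln by (intro mult_left_mono) auto
  \<comment> \<open>With \<open>d \<ge> 1\<close> this forces \<open>N \<ge> 100\<close>, and it
    leaves room for \<open>2 * m + d \<le> N\<close>.\<close>
  then have dN: "100 * real d \<le> real N" using dln by simp
  then have N: "100 \<le> N" using d(1) by linarith
  have m: "2 \<le> m" "2 * m + d \<le> N" using N dN unfolding m_def by linarith+
  note bounds = hit_before_bounds[OF part d(1) x z max m, folded P_def S_def]
  show "0 \<le> 1 - 1 / real N - hit_before (Gamma N d lab) (trans_prob N d lab) x z x"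
    using bounds(1) by (simp add: P_def)
  have S1: "1 \<le> S"
  proof -
    have "1 = (\<Sum>i\<in>{0}. 1 / real ((N - 1) choose i))" by simp
    also have "\<dots> \<le> S" unfolding S_def using m by (intro sum_mono2) auto
    finally show ?thesis .
  qed
  \<comment> \<open>Since \<open>P \<le> 1 \<le> S\<close>, the product \<open>P * S\<close> is at
    most \<open>P + (S - 1)\<close>, which avoids dividing by \<open>S\<close>.\<close>
  have "P \<le> 1" using bounds(1) by (rule order_trans) simp
  then have "P * (S - 1) \<le> 1 * (S - 1)" using S1 by (intro mult_right_mono) auto
  then have "P * S \<le> P + (S - 1)" by (simp add: algebra_simps)
  moreover have "S \<le> 1 + 1 / real N + 3 / real N ^ 2 + 5000 / real N ^ 3"
    unfolding S_def by (rule sum_inverse_binomial_le[OF N m_def])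
  moreover have "1 - 4 * 50 ^ 5 / real N ^ 3 \<le> P * S"
    using bounds(2) error_term_le[OF N dln m_def] by linarith
  ultimately have "1 - 1 / real N - P \<le> 3 / real N ^ 2 + (5000 / real N ^ 3 + 4 * 50 ^ 5 / real N ^ 3)"
    by linarith
  also have "5000 / real N ^ 3 + 4 * 50 ^ 5 / real N ^ 3 = K / real N ^ 3"
    by (simp add: K_def add_divide_distrib)
  \<comment> \<open>The error of order \<open>N^(-3)\<close> is weakened to \<open>N^(-5/2)\<close>;
    the factor 3 allows \<open>3 / N^2\<close> to be pulled out.\<close>
  also have "K / real N ^ 3 \<le> 3 * K / (real N ^ 2 * sqrt (real N))"
  proof (rule frac_le)
    have "sqrt (real N) \<le> real N"
      using N by (intro real_le_lsqrt) (auto simp: power2_eq_square)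
    then show "real N ^ 2 * sqrt (real N) \<le> real N ^ 3"
      unfolding power3_eq_cube power2_eq_square by (intro mult_left_mono) auto
  qed (use N in \<open>auto simp: K_def\<close>)
  also have "3 / real N ^ 2 + 3 * K / (real N ^ 2 * sqrt (real N)) = 3 / real N ^ 2 * (1 + K / sqrt (real N))"
    by (simp add: distrib_left)
  finally show "1 - 1 / real N - hit_before (Gamma N d lab) (trans_prob N d lab) x z x
      \<le> 3 / real N ^ 2 * (1 + (5000 + 4 * 50 ^ 5) / sqrt (real N))"
    by (simp add: P_def K_def)
qed simp_all

end
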